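(* Let $d\ge 2$ and $r\ge 2$ be integers. Let $K(\bar x)=S(\bar x)+R(\bar x)$ be a polynomial in $\bar x=(x_1,\dots,x_d)$ with real coefficients, where $S$ is one of the symmetric polynomials $$\prod_{i=1}^d x_i,\qquad \sum_{i=1}^d x_i^r,\qquad\text{or}\qquad \sum_{1\le i\le j\le d} x_ix_j,$$ and $\deg(R)<\deg(S)$. Assume that $\alpha_1,\dots,\alpha_d$ are positive real numbers that do not satisfy any algebraic relation of degree less than $\deg(S)$, and that $\beta_1,\dots,\beta_d$ are positive real numbers that do not satisfy any algebraic relation of degree less than $\deg(S)$. If for every integer $n\ge 1$ $$K(\lfloor n\alpha_1\rfloor,\dots,\lfloor n\alpha_d\rfloor)=K(\lfloor n\beta_1\rfloor,\dots,\lfloor n\beta_d\rfloor),$$ then $\{\alpha_i : 1\le i\le d\}=\{\beta_i : 1\le i\le d\}$.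
   Context: Real numbers $\xi_1,\dots,\xi_d$ satisfy an algebraic relation of degree less than $D$ if there is a nonzero polynomial $P\in\mathbb{Q}[x_1,\dots,x_d]$ of total degree less than $D$ with $P(\xi_1,\dots,\xi_d)=0$. Degrees of multivariate polynomials are total degrees. *)

theory Defs
  imports Complex_Main "HOL-Library.Poly_Mapping"
begin

text \<open>
  Multivariate polynomials as finitely supported maps from monomials (finitely supported
  exponent vectors) to coefficients; the ring operations are those of \<open>poly_mapping\<close>, whose
  multiplication is convolution. A polynomial in \<open>x_1, ..., x_d\<close> is one whose variable
  indices lie in \<open>{1..d}\<close>.
\<close>

type_synonym 'a mpoly = "(nat \<Rightarrow>\<^sub>0 nat) \<Rightarrow>\<^sub>0 'a"

definition mpoly_var :: "nat \<Rightarrow> 'a::zero_neq_one mpoly" where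
  "mpoly_var i = Poly_Mapping.single (Poly_Mapping.single i 1) 1"

definition mpoly_vars :: "'a::zero mpoly \<Rightarrow> nat set" where
  "mpoly_vars P = (\<Union>m\<in>Poly_Mapping.keys P. Poly_Mapping.keys m)"

definition monom_degree :: "(nat \<Rightarrow>\<^sub>0 nat) \<Rightarrow> nat" where
  "monom_degree m = (\<Sum>i\<in>Poly_Mapping.keys m. Poly_Mapping.lookup m i)"

text \<open>The zero polynomial gets total degree \<open>0\<close>.\<close>

definition mpoly_total_degree :: "'a::zero mpoly \<Rightarrow> nat" where
  "mpoly_total_degree P = Max (insert 0 (monom_degree ` Poly_Mapping.keys P))"

definition mpoly_eval :: "(nat \<Rightarrow> 'a) \<Rightarrow> 'a::comm_semiring_1 mpoly \<Rightarrow> 'a" where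
  "mpoly_eval \<xi> P = (\<Sum>m\<in>Poly_Mapping.keys P.
     Poly_Mapping.lookup P m * (\<Prod>i\<in>Poly_Mapping.keys m. \<xi> i ^ Poly_Mapping.lookup m i))"

definition satisfies_algebraic_relation_lt :: "nat \<Rightarrow> (nat \<Rightarrow> real) \<Rightarrow> nat \<Rightarrow> bool" where
  "satisfies_algebraic_relation_lt d \<xi> D \<longleftrightarrow>
     (\<exists>P :: rat mpoly. P \<noteq> 0 \<and> mpoly_vars P \<subseteq> {1..d} \<and> mpoly_total_degree P < D \<and>
        mpoly_eval \<xi> (Poly_Mapping.map real_of_rat P) = 0)"

end

theory Submission
  imports Defs "HOL-Analysis.Analysis"
begin

text \<open>
  Let \<open>D = deg S\<close> and expand \<open>K(\<lfloor>n\<alpha>\<^sub>1\<rfloor>, \<dots>, \<lfloor>n\<alpha>\<^sub>d\<rfloor>)\<close> in powers of \<open>n\<close>, using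
  \<open>\<lfloor>n\<alpha>\<^sub>i\<rfloor> = n\<alpha>\<^sub>i - {n\<alpha>\<^sub>i}\<close>. The order \<open>n^D\<close> gives \<open>S(\<alpha>) = S(\<beta>)\<close>. At the order \<open>n^(D-1)\<close> the
  summand \<open>R\<close> contributes only a constant, so with \<open>a = grad S(\<alpha>)\<close> and \<open>b = grad S(\<beta>)\<close> the sequence
  \<open>\<Sum>\<^sub>i a\<^sub>i {n\<alpha>\<^sub>i} - \<Sum>\<^sub>i b\<^sub>i {n\<beta>\<^sub>i}\<close> converges (\<open>value_and_gradient_match\<close>). All \<open>a\<^sub>i\<close> and \<open>b\<^sub>i\<close> are
  positive, because the \<open>\<alpha>\<^sub>i\<close> and \<open>\<beta>\<^sub>i\<close> are.

  The heart of the proof is that such a convergence forces \<open>b\<close> to be a permutation of \<open>a\<close>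
  (\<open>amplitudes_match\<close>). Since \<open>D \<ge> 2\<close>, there is no linear relation over \<open>\<rat>\<close> between \<open>1\<close> and two
  of the \<open>\<alpha>\<^sub>i\<close>, and likewise for \<open>\<beta>\<close>. Averaging the sequence against \<open>sin (2\<pi>n\<alpha>\<^sub>p)\<close> reads off
  Fourier coefficients of the sawtooth \<open>{x} - 1/2 = - \<Sum>\<^sub>k sin (2\<pi>kx) / (\<pi>k)\<close>: the term
  \<open>{n\<beta>\<^sub>q}\<close> contributes \<open>- 1 / (2\<pi>k)\<close> if \<open>k\<beta>\<^sub>q \<equiv> \<alpha>\<^sub>p\<close> modulo \<open>1\<close> for some integer \<open>k \<noteq> 0\<close>, and \<open>0\<close>
  otherwise (\<open>has_mean_sawtooth_sin_resonant\<close>, \<open>has_mean_sawtooth_sin_nonresonant\<close>). By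
  independence only the \<open>p\<close>-th term survives among the \<open>\<alpha>\<^sub>i\<close> and at most one among the \<open>\<beta>\<^sub>j\<close>.
  As \<open>a\<^sub>p > 0\<close>, there is exactly one such \<open>q\<close>, and \<open>b\<^sub>q = k a\<^sub>p\<close>, whence \<open>k \<ge> 1\<close>
  and \<open>a\<^sub>p \<le> b\<^sub>q\<close>. The map taking \<open>p\<close> to \<open>q\<close> is injective, so \<open>\<Sum> a\<^sub>i \<le> \<Sum> b\<^sub>i\<close>; exchanging the two sides
  gives equality of the sums, and therefore of all matched amplitudes.

  It remains to recover \<open>\<alpha>\<close>, up to a permutation \<open>\<sigma>\<close>, from the value and the gradient of \<open>S\<close>. For the
  product, \<open>\<alpha>\<^sub>i\<close> is \<open>S\<close> divided by its \<open>i\<close>-th partial derivative. For the power sum, the \<open>i\<close>-th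
  partial derivative \<open>r \<alpha>\<^sub>i^(r-1)\<close> determines the positive number \<open>\<alpha>\<^sub>i\<close>. For the quadratic form it is
  \<open>\<alpha>\<^sub>i + \<Sum>\<^sub>j \<alpha>\<^sub>j\<close>, and these numbers add up to \<open>(d + 1) \<Sum>\<^sub>j \<alpha>\<^sub>j\<close>.
\<close>

section \<open>Means of sequences\<close>

definition has_mean :: "(nat \<Rightarrow> real) \<Rightarrow> real \<Rightarrow> bool" where
  "has_mean f c \<longleftrightarrow> (\<lambda>N. (\<Sum>n<N. f n) / real N) \<longlonglongrightarrow> c"

lemma has_mean_diff:
  "has_mean f c \<Longrightarrow> has_mean g e \<Longrightarrow> has_mean (\<lambda>n. f n - g n) (c - e)"
  unfolding has_mean_def by (simp add: sum_subtractf diff_divide_distrib tendsto_diff)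

lemma has_mean_cmult:
  "has_mean f c \<Longrightarrow> has_mean (\<lambda>n. k * f n) (k * c)"
  unfolding has_mean_def
  by (simp flip: sum_distrib_left times_divide_eq_right add: tendsto_mult_left)

lemma has_mean_sum:
  assumes "\<And>i. i \<in> I \<Longrightarrow> has_mean (f i) (c i)"
  shows "has_mean (\<lambda>n. \<Sum>i\<in>I. f i n) (\<Sum>i\<in>I. c i)"
proof -
  have "(\<lambda>N. \<Sum>i\<in>I. (\<Sum>n<N. f i n) / real N) \<longlonglongrightarrow> (\<Sum>i\<in>I. c i)"
    using assms by (intro tendsto_sum) (auto simp: has_mean_def)
  moreover have "(\<Sum>i\<in>I. (\<Sum>n<N. f i n) / real N) = (\<Sum>n<N. \<Sum>i\<in>I. f i n) / real N" for N
    by (simp add: sum.swap[of _ I] flip: sum_divide_distrib)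
  ultimately show ?thesis unfolding has_mean_def by simp
qed

lemma has_mean_unique: "has_mean f c \<Longrightarrow> has_mean f e \<Longrightarrow> c = e"
  unfolding has_mean_def by (rule LIMSEQ_unique)

text \<open>
  The error of the approximation is controlled only on average, which is what is available for a
  discontinuous function such as the sawtooth: no approximation by trigonometric polynomials is
  uniform near its jumps.
\<close>

lemma has_mean_approx:
  assumes "\<And>\<epsilon>. \<epsilon> > 0 \<Longrightarrow> \<exists>g e. has_mean g e \<and> \<bar>e - c\<bar> \<le> \<epsilon> \<and>
     (\<forall>\<^sub>F N in sequentially. (\<Sum>n<N. \<bar>f n - g n\<bar>) \<le> \<epsilon> * real N)"
  shows "has_mean f c"
  unfolding has_mean_def
proof (rule tendstoI)
  fix r :: real assume "r > 0"
  then obtain g e where g: "has_mean g e" "\<bar>e - c\<bar> \<le> r / 4"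
    and ev: "\<forall>\<^sub>F N in sequentially. (\<Sum>n<N. \<bar>f n - g n\<bar>) \<le> r / 4 * real N"
    using assms[of "r / 4"] by auto
  have "\<forall>\<^sub>F N in sequentially. dist ((\<Sum>n<N. g n) / real N) e < r / 4"
    using g(1) \<open>r > 0\<close> unfolding has_mean_def by (intro tendstoD) auto
  with ev eventually_gt_at_top[of 0]
  show "\<forall>\<^sub>F N in sequentially. dist ((\<Sum>n<N. f n) / real N) c < r"
  proof eventually_elim
    case (elim N)
    have "\<bar>(\<Sum>n<N. f n) / N - (\<Sum>n<N. g n) / N\<bar> = \<bar>\<Sum>n<N. f n - g n\<bar> / N"
      using elim(2) by (simp add: sum_subtractf flip: diff_divide_distrib)
    also have "\<dots> \<le> (r / 4 * N) / N"
      using elim(1) sum_abs[of "\<lambda>n. f n - g n" "{..<N}"]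
      by (intro divide_right_mono order_trans[OF sum_abs]) auto
    also have "\<dots> = r / 4" using elim(2) by simp
    finally show ?case using elim(3) g(2) \<open>r > 0\<close> unfolding dist_real_def by linarith
  qed
qed

lemma has_mean_if_tendsto:
  assumes "f \<longlonglongrightarrow> c" 
  shows "has_mean f c"
proof (rule has_mean_approx)
  fix \<epsilon> :: real assume "\<epsilon> > 0"
  then obtain m where m: "\<And>n. n \<ge> m \<Longrightarrow> \<bar>f n - c\<bar> < \<epsilon> / 2"
    using LIMSEQ_D[OF assms, of "\<epsilon> / 2"] by auto
  define A where "A = (\<Sum>n<m. \<bar>f n - c\<bar>)"
  have "(\<Sum>n<N. \<bar>f n - c\<bar>) \<le> A + N * (\<epsilon> / 2)" for N
  proof (induction N)
    case (Suc N)
    show ?case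
    proof (cases "N < m")
      case True
      then have "(\<Sum>n<Suc N. \<bar>f n - c\<bar>) \<le> A"
        unfolding A_def by (intro sum_mono2) auto
      also have "A \<le> A + Suc N * (\<epsilon> / 2)" using \<open>\<epsilon> > 0\<close> by simp
      finally show ?thesis .
    next
      case False
      then have "\<bar>f N - c\<bar> \<le> \<epsilon> / 2" using m[of N] by simp
      moreover have "real (Suc N) * (\<epsilon> / 2) = real N * (\<epsilon> / 2) + \<epsilon> / 2"
        by (simp add: distrib_right)
      ultimately show ?thesis using Suc unfolding sum.lessThan_Suc by linarith
    qed
  qed (simp add: A_def)
  moreover have "\<forall>\<^sub>F N in sequentially. A \<le> real N * (\<epsilon> / 2)"
  proof -
    obtain m :: nat where m: "A < real m * (\<epsilon> / 2)"
      using ex_less_of_nat_mult[of "\<epsilon> / 2" A] \<open>\<epsilon> > 0\<close> by auto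
    show ?thesis
      using eventually_ge_at_top[of m]
    proof eventually_elim
      case (elim N)
      then have "real m * (\<epsilon> / 2) \<le> real N * (\<epsilon> / 2)"
        using \<open>\<epsilon> > 0\<close> by (intro mult_right_mono) auto
      with m show ?case by linarith
    qed
  qed
  ultimately have "\<forall>\<^sub>F N in sequentially. (\<Sum>n<N. \<bar>f n - c\<bar>) \<le> \<epsilon> * real N"
  proof (elim eventually_mono)
    fix N :: nat
    assume le: "\<And>N. (\<Sum>n<N. \<bar>f n - c\<bar>) \<le> A + real N * (\<epsilon> / 2)" "A \<le> real N * (\<epsilon> / 2)"
    have "\<epsilon> * real N = real N * (\<epsilon> / 2) + real N * (\<epsilon> / 2)" by simp
    with le(1)[of N] le(2) show "(\<Sum>n<N. \<bar>f n - c\<bar>) \<le> \<epsilon> * real N" by linarith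
  qed
  moreover have "has_mean (\<lambda>_. c) c"
    unfolding has_mean_def
    by (rule tendsto_eventually, rule eventually_mono[OF eventually_gt_at_top[of 0]]) auto
  ultimately show "\<exists>g e. has_mean g e \<and> \<bar>e - c\<bar> \<le> \<epsilon> \<and>
     (\<forall>\<^sub>F N in sequentially. (\<Sum>n<N. \<bar>f n - g n\<bar>) \<le> \<epsilon> * real N)"
    using \<open>\<epsilon> > 0\<close> by (intro exI[of _ "\<lambda>_. c"] exI[of _ c]) auto
qed

lemma cis_eq_1_iff_Ints:
  fixes x :: real
  shows "cis (2 * pi * x) = 1 \<longleftrightarrow> x \<in> \<int>"
proof
  assume "cis (2 * pi * x) = 1"
  then have "cos (2 * pi * x) = 1" by (simp add: complex_eq_iff)
  then obtain m :: int where "2 * pi * x = m * 2 * pi" by (auto simp: cos_one_2pi_int)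
  then show "x \<in> \<int>" by simp
qed (auto simp: cis_multiple_2pi)

text \<open>
  For non-integral \<open>\<phi>\<close> the partial sums are real parts of a geometric sum with ratio
  \<open>exp (2\<pi>i\<phi>) \<noteq> 1\<close> and hence bounded. The phase \<open>c\<close> lets one statement cover both sine and cosine.
\<close>

lemma has_mean_cos_shift:
  fixes \<phi> c :: real
  shows "has_mean (\<lambda>n. cos (2 * pi * (n * \<phi>) + c)) (if \<phi> \<in> \<int> then cos c else 0)"
proof (cases "\<phi> \<in> \<int>")
  case True
  have "cos (2 * pi * (n * \<phi>) + c) = cos c" for n :: nat
    using True by (simp add: cos_add cos_integer_2pi sin_integer_2pi)
  then show ?thesis using True by (simp add: has_mean_if_tendsto)
next
  case False
  define w where "w = cis (2 * pi * \<phi>)"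
  have w: "w \<noteq> 1" using False by (simp add: w_def cis_eq_1_iff_Ints)
  have Re: "cos (2 * pi * (n * \<phi>) + c) = Re (cis c * w ^ n)" for n :: nat
    unfolding w_def Complex.DeMoivre cis_mult by (simp add: mult_ac add_ac)
  have bnd: "\<bar>(\<Sum>n<N. cos (2 * pi * (n * \<phi>) + c))\<bar> \<le> 2 / cmod (1 - w)" for N :: nat
  proof -
    have "\<bar>(\<Sum>n<N. cos (2 * pi * (n * \<phi>) + c))\<bar> = \<bar>Re (cis c * (\<Sum>n<N. w ^ n))\<bar>"
      unfolding Re sum_distrib_left Re_sum ..
    also have "\<dots> \<le> cmod (cis c * (\<Sum>n<N. w ^ n))" by (rule abs_Re_le_cmod)
    also have "\<dots> = cmod ((1 - w ^ N) / (1 - w))"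
      unfolding norm_mult using w by (simp add: sum_gp_strict)
    also have "\<dots> = cmod (1 - w ^ N) / cmod (1 - w)"
      by (rule norm_divide)
    also have "cmod (1 - w ^ N) \<le> 2"
      using norm_triangle_ineq4[of 1 "w ^ N"] by (simp add: norm_power w_def)
    then have "cmod (1 - w ^ N) / cmod (1 - w) \<le> 2 / cmod (1 - w)"
      by (rule divide_right_mono) simp
    finally show ?thesis .
  qed
  have "(\<lambda>N. (\<Sum>n<N. cos (2 * pi * (real n * \<phi>) + c)) / real N) \<longlonglongrightarrow> 0"
  proof (rule Lim_null_comparison[where g = "\<lambda>N. 2 / cmod (1 - w) / real N"])
    show "(\<lambda>N. 2 / cmod (1 - w) / real N) \<longlonglongrightarrow> 0"
      by (rule lim_const_over_n)
    show "\<forall>\<^sub>F N::nat in sequentially.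
        norm ((\<Sum>n<N. cos (2 * pi * (n * \<phi>) + c)) / real N) \<le> 2 / cmod (1 - w) / real N"
      using divide_right_mono[OF bnd] by (intro always_eventually allI) simp
  qed
  then show ?thesis using False by (simp add: has_mean_def)
qed

lemma has_mean_sin:
  fixes \<phi> :: real
  shows "has_mean (\<lambda>n. sin (2 * pi * (n * \<phi>))) 0"
  using has_mean_cos_shift[of \<phi> "- (pi / 2)"] by (simp add: cos_diff split: if_splits)

lemma has_mean_sin_sin:
  fixes x y :: real
  shows
  "has_mean (\<lambda>n. sin (2 * pi * (n * x)) * sin (2 * pi * (n * y)))
     ((of_bool (x - y \<in> \<int>) - of_bool (x + y \<in> \<int>)) / 2)"
proof -
  have *: "sin (2 * pi * (n * x)) * sin (2 * pi * (n * y)) =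
      1 / 2 * (cos (2 * pi * (n * (x - y))) - cos (2 * pi * (n * (x + y))))" for n :: nat
    by (simp add: sin_times_sin right_diff_distrib distrib_left)
  show ?thesis unfolding *
    using has_mean_cmult[OF has_mean_diff
        [OF has_mean_cos_shift[of "x - y" 0] has_mean_cos_shift[of "x + y" 0]], of "1/2"]
    by (cases "x - y \<in> \<int>"; cases "x + y \<in> \<int>") simp_all
qed

section \<open>Fourier coefficients of the sawtooth along an irrational rotation\<close>

definition sawtooth :: "real \<Rightarrow> real" where "sawtooth x = frac x - 1 / 2"

text \<open>
  The Abel means of the Fourier series \<open>- \<Sum>\<^sub>k sin (2\<pi>kx) / (\<pi>k)\<close> of the sawtooth, summed in closed
  form through the power series of the logarithm. For \<open>\<rho> < 1\<close> the series converges absolutely,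
  so that means over \<open>n\<close> can be taken term by term.
\<close>

definition sawtooth_abel :: "real \<Rightarrow> real \<Rightarrow> real" where
  "sawtooth_abel \<rho> x = Im (Ln (1 - \<rho> * cis (2 * pi * x))) / pi"

lemma abs_sawtooth_le: "\<bar>sawtooth x\<bar> \<le> 1 / 2"
  using frac_ge_0[of x] frac_lt_1[of x] unfolding sawtooth_def by linarith

lemma sawtooth_abel_frac: "sawtooth_abel \<rho> (frac x) = sawtooth_abel \<rho> x"
proof -
  have "cis (2 * pi * x) = cis (2 * pi * of_int \<lfloor>x\<rfloor>) * cis (2 * pi * frac x)"
    unfolding cis_mult by (simp add: frac_def algebra_simps)
  then show ?thesis by (simp add: sawtooth_abel_def cis_multiple_2pi)
qed

text \<open>
  The formula holds because \<open>1 - exp (2\<pi>it) = 2 sin (\<pi>t) exp (i(\<pi>t - \<pi>/2))\<close>, where the sine is positive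
  and the phase lies in the range of the principal argument.
\<close>

lemma sawtooth_abel_1:
  assumes "0 < t" "t < 1"
  shows "sawtooth_abel 1 t = t - 1 / 2"
proof -
  have s: "sin (pi * t) > 0" using assms by (intro sin_gt_zero) auto
  have "1 - cis (2 * pi * t) = complex_of_real (2 * sin (pi * t)) * cis (pi * t - pi / 2)"
    using sin_double[of "pi * t"] cos_double_sin[of "pi * t"]
    by (simp add: complex_eq_iff power2_eq_square mult_ac cos_diff sin_diff)
  also have "\<dots> = exp (of_real (ln (2 * sin (pi * t))) + \<i> * of_real (pi * t - pi / 2))"
    using s by (simp add: exp_add cis_conv_exp exp_of_real)
  finally have "1 - cis (2 * pi * t) =
     exp (of_real (ln (2 * sin (pi * t))) + \<i> * of_real (pi * t - pi / 2))" (is "_ = exp ?w") .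
  moreover have w: "Im ?w = pi * t - pi / 2" by simp
  moreover have "pi * t < pi * 1" "pi * t > 0" using assms by (auto intro!: mult_strict_left_mono)
  then have "Ln (exp ?w) = ?w"
    unfolding w by (intro Ln_exp) (unfold w, linarith+)
  ultimately have "Im (Ln (1 - cis (2 * pi * t))) = pi * t - pi / 2"
    by (simp only:)
  then show ?thesis by (simp add: sawtooth_abel_def field_simps)
qed

text \<open>
  This crude bound, uniform in \<open>\<rho>\<close>, serves at the points close to an integer, where the Abel means do
  not converge uniformly.
\<close>

lemma abs_sawtooth_abel_le:
  assumes "0 \<le> \<rho>" "\<rho> < 1"
  shows "\<bar>sawtooth_abel \<rho> x\<bar> \<le> 1"
proof -
  have "1 - \<rho> * cis (2 * pi * x) \<noteq> 0"
  proof
    assume "1 - \<rho> * cis (2 * pi * x) = 0"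
    then have "cmod (\<rho> * cis (2 * pi * x)) = 1" by simp
    with assms show False by (simp add: norm_mult)
  qed
  then show ?thesis
    using mpi_less_Im_Ln[of "1 - \<rho> * cis (2 * pi * x)"] Im_Ln_le_pi[of "1 - \<rho> * cis (2 * pi * x)"]
    by (simp add: sawtooth_abel_def abs_le_iff field_simps)
qed

text \<open>
  Away from the jumps at the integers \<open>1 - \<rho> exp (2\<pi>it)\<close> stays off the branch cut up to and including
  \<open>\<rho> = 1\<close>, so the Abel means are uniformly continuous on the compact set of all these \<open>(\<rho>, t)\<close>.
\<close>

lemma sawtooth_abel_tendsto_uniformly:
  assumes "\<delta> > 0" "\<epsilon> > 0"
  shows "\<forall>\<^sub>F \<rho> in at_left 1. \<forall>t\<in>{\<delta>..1-\<delta>}. \<bar>sawtooth_abel \<rho> t - (t - 1 / 2)\<bar> \<le> \<epsilon>"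
proof -
  define K where "K = {0..1::real} \<times> {\<delta>..1-\<delta>}"
  have cont: "continuous_on K (\<lambda>p. sawtooth_abel (fst p) (snd p))"
    unfolding sawtooth_abel_def
  proof (intro continuous_intros)
    fix p assume "p \<in> K"
    then have p: "0 \<le> fst p" "fst p \<le> 1" "\<delta> \<le> snd p" "snd p \<le> 1 - \<delta>" by (auto simp: K_def)
    have "cos (2 * pi * snd p) < 1"
    proof -
      have "cos (2 * pi * snd p) = 1 - 2 * (sin (pi * snd p))\<^sup>2"
        using cos_double_sin[of "pi * snd p"] by (simp add: mult_ac)
      moreover have "sin (pi * snd p) > 0" using p assms by (intro sin_gt_zero) auto
      ultimately show ?thesis by simp
    qed
    moreover have "fst p * cos (2 * pi * snd p) \<le> max 0 (cos (2 * pi * snd p))"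
      using p by (cases "cos (2 * pi * snd p) \<ge> 0")
        (auto simp: mult_left_le_one_le mult_nonneg_nonpos)
    ultimately have "Re (1 - fst p * cis (2 * pi * snd p)) > 0" by simp
    then show "1 - fst p * cis (2 * pi * snd p) \<notin> \<real>\<^sub>\<le>\<^sub>0"
      by (auto simp: complex_nonpos_Reals_iff)
  qed auto
  have "compact K" unfolding K_def by (intro compact_Times) auto
  with cont have "uniformly_continuous_on K (\<lambda>p. sawtooth_abel (fst p) (snd p))"
    by (rule compact_uniformly_continuous)
  then obtain \<eta> where "\<eta> > 0"
    and \<eta>: "\<And>p q. p \<in> K \<Longrightarrow> q \<in> K \<Longrightarrow> dist q p < \<eta> \<Longrightarrow>
      dist (sawtooth_abel (fst q) (snd q)) (sawtooth_abel (fst p) (snd p)) < \<epsilon>"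
    using \<open>\<epsilon> > 0\<close> unfolding uniformly_continuous_on_def by metis
  have "\<forall>\<^sub>F \<rho> in at_left (1::real). \<rho> \<in> {max 0 (1 - \<eta>)<..<1}"
    using \<open>\<eta> > 0\<close> by (intro eventually_at_left_real) auto
  then show ?thesis
  proof eventually_elim
    case (elim \<rho>)
    show ?case
    proof
      fix t assume t: "t \<in> {\<delta>..1-\<delta>}"
      have "dist (\<rho>, t) (1, t) < \<eta>" using elim by (auto simp: dist_Pair_Pair dist_real_def)
      then have "dist (sawtooth_abel \<rho> t) (sawtooth_abel 1 t) < \<epsilon>"
        using \<eta>[of "(1, t)" "(\<rho>, t)"] t elim by (auto simp: K_def)
      then show "\<bar>sawtooth_abel \<rho> t - (t - 1 / 2)\<bar> \<le> \<epsilon>"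
        using sawtooth_abel_1[of t] t assms by (auto simp: dist_real_def)
    qed
  qed
qed

lemma sawtooth_abel_sums:
  fixes x :: real
  assumes "0 \<le> \<rho>" "\<rho> < 1"
  shows "(\<lambda>k. - (\<rho> ^ k / (pi * k)) * sin (2 * pi * (k * x))) sums sawtooth_abel \<rho> x"
proof -
  define z where "z = - (\<rho> * cis (2 * pi * x))"
  have "cmod z < 1" using assms by (simp add: z_def norm_mult)
  then have "(\<lambda>k. Im (- ((-z) ^ k) / of_nat k) / pi) sums (Im (ln (1 + z)) / pi)"
    by (intro sums_divide sums_Im Ln_series')
  moreover have "Im (- ((-z) ^ k) / of_nat k) / pi = - (\<rho> ^ k / (pi * k)) * sin (2 * pi * (k * x))"
    for k :: nat
  proof -
    have "(-z) ^ k = of_real (\<rho> ^ k) * cis (2 * pi * (k * x))"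
      unfolding z_def by (simp add: power_mult_distrib Complex.DeMoivre mult.left_commute)
    then have "Im (- ((-z) ^ k) / of_nat k) = - (\<rho> ^ k * sin (2 * pi * (k * x))) / k"
      by (simp only: Im_divide_of_nat Im_complex_of_real mult.left_commute) simp
    then show ?thesis by (simp only:) simp
  qed
  ultimately show ?thesis by (simp add: sawtooth_abel_def z_def)
qed

text \<open>
  If \<open>n\<alpha>\<close> and \<open>n'\<alpha>\<close> are both close to integers, so is \<open>(n' - n)\<alpha>\<close>. As \<open>q\<alpha>\<close> keeps a positive distance
  from the integers for \<open>0 < q < Q\<close>, each block of \<open>Q\<close> consecutive indices contains at most one close
  multiple, once \<open>\<delta>\<close> is half that distance. This much of equidistribution suffices to neglect the
  jumps of the sawtooth.
\<close>

lemma irrational_close_multiples_sparse: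
  fixes \<alpha> \<epsilon> :: real
  assumes irr: "\<alpha> \<notin> \<rat>" and "\<epsilon> > 0"
  obtains \<delta> where "\<delta> > 0"
    "\<forall>\<^sub>F N in sequentially. real (card {n\<in>{..<N}. frac (n * \<alpha>) \<notin> {\<delta>..1 - \<delta>}}) \<le> \<epsilon> * N"
proof -
  obtain Q :: nat where Q: "2 / \<epsilon> < Q" using reals_Archimedean2 by blast
  have "Q > 0" using Q \<open>\<epsilon> > 0\<close> by (cases Q) (auto simp: field_simps)
  \<comment> \<open>The \<open>1\<close> only keeps the set nonempty when \<open>Q = 1\<close>.\<close>
  define h where "h = Min (insert 1 ((\<lambda>q. \<bar>real q * \<alpha> - round (real q * \<alpha>)\<bar>) ` {0<..<Q}))"
  have h_le: "h \<le> \<bar>real q * \<alpha> - round (real q * \<alpha>)\<bar>" if "0 < q" "q < Q" for q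
    unfolding h_def using that by (intro Min_le) auto
  have "real q * \<alpha> - round (real q * \<alpha>) \<noteq> 0" if "0 < q" for q
  proof
    assume "real q * \<alpha> - round (real q * \<alpha>) = 0"
    then have "\<alpha> = of_int (round (real q * \<alpha>)) / of_nat q" using that by (simp add: field_simps)
    then show False using irr by (metis Rats_divide Rats_of_int Rats_of_nat)
  qed
  then have "h > 0" unfolding h_def by (subst Min_gr_iff) auto
  define \<delta> where "\<delta> = h / 2"
  have "\<delta> > 0" using \<open>h > 0\<close> by (simp add: \<delta>_def)
  define B where "B = (\<lambda>N. {n\<in>{..<N}. frac (real n * \<alpha>) \<notin> {\<delta>..1 - \<delta>}})"
  have gap: "n' \<ge> n + Q" if "n \<in> B N" "n' \<in> B N" "n < n'" for n n' N
  proof (rule ccontr)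
    assume "\<not> n' \<ge> n + Q"
    then have q: "0 < n' - n" "n' - n < Q" using that by auto
    have close: "\<exists>m::int. \<bar>real k * \<alpha> - m\<bar> < \<delta>" if "k \<in> B N" for k
    proof (cases "frac (real k * \<alpha>) < \<delta>")
      case True
      then show ?thesis
        by (intro exI[of _ "\<lfloor>real k * \<alpha>\<rfloor>"]) (use frac_ge_0[of "real k * \<alpha>"] in \<open>simp add: frac_def\<close>)
    next
      case False
      then have "frac (real k * \<alpha>) > 1 - \<delta>" using that by (auto simp: B_def)
      then show ?thesis
        by (intro exI[of _ "\<lfloor>real k * \<alpha>\<rfloor> + 1"])
          (use frac_lt_1[of "real k * \<alpha>"] in \<open>simp add: frac_def abs_if\<close>)
    qed
    from close[OF that(1)] obtain m :: int where m: "\<bar>real n * \<alpha> - m\<bar> < \<delta>" by blast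
    from close[OF that(2)] obtain m' :: int where m': "\<bar>real n' * \<alpha> - m'\<bar> < \<delta>" by blast
    have "h \<le> \<bar>real (n' - n) * \<alpha> - round (real (n' - n) * \<alpha>)\<bar>" using q by (rule h_le)
    also have "\<dots> = \<bar>of_int (round (real (n' - n) * \<alpha>)) - real (n' - n) * \<alpha>\<bar>" by simp
    also have "\<dots> \<le> \<bar>of_int (m' - m) - real (n' - n) * \<alpha>\<bar>"
      using round_diff_minimal[of "real (n' - n) * \<alpha>" "m' - m"] by (simp only: abs_minus_commute)
    also have "real (n' - n) * \<alpha> = real n' * \<alpha> - real n * \<alpha>"
      using \<open>n < n'\<close> by (simp add: of_nat_diff left_diff_distrib)
    also have "\<bar>of_int (m' - m) - (real n' * \<alpha> - real n * \<alpha>)\<bar> < h"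
      using m m' unfolding \<delta>_def of_int_diff by linarith
    finally show False by simp
  qed
  have inj: "inj_on (\<lambda>n. n div Q) (B N)" for N
  proof (rule linorder_inj_onI)
    fix n n' assume "n < n'" "n \<in> B N" "n' \<in> B N"
    then have "(n + Q) div Q \<le> n' div Q" using gap by (intro div_le_mono) auto
    then show "n div Q \<noteq> n' div Q" using \<open>Q > 0\<close> by simp
  qed auto
  have card_le: "real (card (B N)) \<le> real N / Q + 1" for N
  proof -
    have "(\<lambda>n. n div Q) ` B N \<subseteq> {..N div Q}"
      by (auto simp: B_def intro!: div_le_mono)
    then have "card (B N) \<le> card {..N div Q}"
      using inj[of N] by (intro card_inj_on_le) auto
    then have "card (B N) \<le> N div Q + 1" by simp
    then have "real (card (B N)) \<le> real (N div Q) + 1" by linarith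
    then show ?thesis using of_nat_div_le_of_nat[of N Q, where 'a = real] by linarith
  qed
  obtain M :: nat where M: "2 / \<epsilon> < M" using reals_Archimedean2 by blast
  have "\<forall>\<^sub>F N in sequentially. real (card (B N)) \<le> \<epsilon> * N"
    using eventually_ge_at_top[of M]
  proof eventually_elim
    case (elim N)
    have "2 / \<epsilon> < N" using M elim by linarith
    then have "1 \<le> \<epsilon> / 2 * N" using \<open>\<epsilon> > 0\<close> by (simp add: field_simps)
    moreover have "1 / Q \<le> \<epsilon> / 2" using Q \<open>Q > 0\<close> \<open>\<epsilon> > 0\<close> by (simp add: field_simps)
    then have "1 / Q * N \<le> \<epsilon> / 2 * N" by (rule mult_right_mono) simp
    moreover have "real N / Q = 1 / Q * N" by simp
    ultimately have "real N / Q + 1 \<le> \<epsilon> / 2 * N + \<epsilon> / 2 * N" by linarith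
    also have "\<dots> = \<epsilon> * N" by simp
    finally show ?case using card_le[of N] by linarith
  qed
  then show thesis using that[of \<delta>] \<open>\<delta> > 0\<close> by (simp add: B_def)
qed

text \<open>
  The contribution of the \<open>k\<close>-th Fourier mode of the sawtooth at \<open>n\<alpha>\<close> to its mean against
  \<open>sin (2\<pi>n\<theta>)\<close>, damped by the Abel factor \<open>\<rho>^k\<close>. It is nonzero only if \<open>k\<alpha> \<equiv> \<theta>\<close> or
  \<open>k\<alpha> \<equiv> -\<theta>\<close> modulo \<open>1\<close>.
\<close>

definition resonant_term :: "real \<Rightarrow> real \<Rightarrow> real \<Rightarrow> nat \<Rightarrow> real" where
  "resonant_term \<rho> \<alpha> \<theta> k = - (\<rho> ^ k / (pi * k)) *
     ((of_bool (k * \<alpha> - \<theta> \<in> \<int>) - of_bool (k * \<alpha> + \<theta> \<in> \<int>)) / 2)"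

text \<open>
  The mean over \<open>n\<close> of the \<open>k\<close>-th term is known from the product formula for sines, and the terms are
  dominated by \<open>\<rho>^k\<close> for all \<open>N\<close>, so Tannery's theorem exchanges the mean with the sum over \<open>k\<close>.
\<close>

lemma has_mean_sawtooth_abel_sin:
  fixes \<alpha> \<theta> \<rho> :: real
  assumes "0 \<le> \<rho>" "\<rho> < 1"
  shows "has_mean (\<lambda>n. sawtooth_abel \<rho> (n * \<alpha>) * sin (2 * pi * (n * \<theta>)))
    (suminf (resonant_term \<rho> \<alpha> \<theta>))"
proof -
  define A where "A = (\<lambda>(k::nat) (N::nat). - (\<rho> ^ k / (pi * k)) *
    ((\<Sum>n<N. sin (2 * pi * (n * (k * \<alpha>))) * sin (2 * pi * (n * \<theta>))) / N))"
  have lim: "A k \<longlonglongrightarrow> resonant_term \<rho> \<alpha> \<theta> k" for k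
    unfolding A_def resonant_term_def
    using has_mean_sin_sin[of "k * \<alpha>" \<theta>] unfolding has_mean_def by (intro tendsto_mult_left)
  have bound: "norm (A k N) \<le> \<rho> ^ k" for k N
  proof -
    have "\<bar>\<Sum>n<N. sin (2 * pi * (n * (k * \<alpha>))) * sin (2 * pi * (n * \<theta>))\<bar> \<le> (\<Sum>n<N. 1)"
      by (intro order_trans[OF sum_abs] sum_mono) (auto simp: abs_mult intro!: mult_le_one)
    then have 1: "\<bar>(\<Sum>n<N. sin (2 * pi * (n * (k * \<alpha>))) * sin (2 * pi * (n * \<theta>))) / N\<bar> \<le> 1"
      by (cases "N = 0") (auto simp: abs_divide)
    have 2: "\<bar>- (\<rho> ^ k / (pi * k))\<bar> \<le> \<rho> ^ k"
    proof (cases "k = 0")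
      case False
      have "1 * 1 \<le> pi * real k" using pi_gt3 False by (intro mult_mono) auto
      then have "\<rho> ^ k / (pi * k) \<le> \<rho> ^ k / 1"
        using assms by (intro divide_left_mono) auto
      then show ?thesis using assms by simp
    qed auto
    have "norm (A k N) = \<bar>- (\<rho> ^ k / (pi * k))\<bar> *
        \<bar>(\<Sum>n<N. sin (2 * pi * (n * (k * \<alpha>))) * sin (2 * pi * (n * \<theta>))) / N\<bar>"
      unfolding A_def real_norm_def by (rule abs_mult)
    also have "\<dots> \<le> \<rho> ^ k * 1" using 1 2 assms by (intro mult_mono) auto
    finally show ?thesis by simp
  qed
  have "(\<lambda>N. suminf (\<lambda>k. A k N)) \<longlonglongrightarrow> suminf (resonant_term \<rho> \<alpha> \<theta>)"
  proof -
    have "\<forall>\<^sub>F (k, N) in sequentially \<times>\<^sub>F sequentially. norm (A k N) \<le> \<rho> ^ k"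
      using bound by (intro always_eventually) auto
    moreover have "summable (\<lambda>k. \<rho> ^ k)" using assms by (intro summable_geometric) auto
    ultimately show ?thesis using tannerys_theorem[OF lim, where M = "\<lambda>k. \<rho> ^ k"] by simp
  qed
  moreover have "(\<lambda>k. A k N) sums
      ((\<Sum>n<N. sawtooth_abel \<rho> (n * \<alpha>) * sin (2 * pi * (n * \<theta>))) / N)" for N :: nat
  proof -
    have "(\<lambda>k. (\<Sum>n<N. - (\<rho> ^ k / (pi * k)) * sin (2 * pi * (k * (n * \<alpha>))) * sin (2 * pi * (n * \<theta>))) / N)
      sums ((\<Sum>n<N. sawtooth_abel \<rho> (n * \<alpha>) * sin (2 * pi * (n * \<theta>))) / N)"
      by (intro sums_divide sums_sum sums_mult2 sawtooth_abel_sums assms)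
    moreover have "(\<Sum>n<N. - (\<rho> ^ k / (pi * k)) * sin (2 * pi * (k * (n * \<alpha>))) * sin (2 * pi * (n * \<theta>))) / N
      = A k N" for k
      unfolding A_def by (simp add: sum_distrib_left sum_divide_distrib mult.assoc mult.left_commute[of "real k"])
    ultimately show ?thesis by simp
  qed
  ultimately show ?thesis unfolding has_mean_def by (simp add: sums_iff)
qed

text \<open>
  The Abel means are within \<open>\<epsilon>/2\<close> of the sawtooth at all \<open>n\<alpha>\<close> except the sparse ones close to an
  integer, where they differ from it by at most \<open>2\<close>. Hence the mean of the sawtooth is the limit of
  the means of its Abel means.
\<close>

lemma has_mean_sawtooth_sin:
  fixes \<alpha> \<theta> c :: real
  assumes irr: "\<alpha> \<notin> \<rat>"
    and lim: "((\<lambda>\<rho>. suminf (resonant_term \<rho> \<alpha> \<theta>)) \<longlongrightarrow> c) (at_left 1)"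
  shows "has_mean (\<lambda>n. sawtooth (n * \<alpha>) * sin (2 * pi * (n * \<theta>))) c"
proof (rule has_mean_approx)
  fix \<epsilon> :: real assume "\<epsilon> > 0"
  obtain \<delta> where "\<delta> > 0" and sparse:
    "\<forall>\<^sub>F N in sequentially. real (card {n\<in>{..<N}. frac (n * \<alpha>) \<notin> {\<delta>..1 - \<delta>}}) \<le> \<epsilon> / 4 * N"
    using irrational_close_multiples_sparse[OF irr, of "\<epsilon> / 4"] \<open>\<epsilon> > 0\<close> by auto
  have "\<forall>\<^sub>F \<rho> in at_left 1. \<bar>suminf (resonant_term \<rho> \<alpha> \<theta>) - c\<bar> < \<epsilon>"
    using tendstoD[OF lim \<open>\<epsilon> > 0\<close>] by (simp add: dist_real_def)
  moreover have "\<forall>\<^sub>F \<rho> in at_left 1. \<forall>t\<in>{\<delta>..1-\<delta>}. \<bar>sawtooth_abel \<rho> t - (t - 1 / 2)\<bar> \<le> \<epsilon> / 2"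
    using \<open>\<delta> > 0\<close> \<open>\<epsilon> > 0\<close> by (intro sawtooth_abel_tendsto_uniformly) auto
  moreover have "\<forall>\<^sub>F \<rho> in at_left (1::real). \<rho> \<in> {0<..<1}"
    by (intro eventually_at_left_real) auto
  ultimately have "\<forall>\<^sub>F \<rho> in at_left 1. \<bar>suminf (resonant_term \<rho> \<alpha> \<theta>) - c\<bar> < \<epsilon> \<and>
      (\<forall>t\<in>{\<delta>..1-\<delta>}. \<bar>sawtooth_abel \<rho> t - (t - 1 / 2)\<bar> \<le> \<epsilon> / 2) \<and> \<rho> \<in> {0<..<1}"
    by eventually_elim blast
  then obtain \<rho> where \<rho>: "\<bar>suminf (resonant_term \<rho> \<alpha> \<theta>) - c\<bar> < \<epsilon>"
      "\<forall>t\<in>{\<delta>..1-\<delta>}. \<bar>sawtooth_abel \<rho> t - (t - 1 / 2)\<bar> \<le> \<epsilon> / 2" "0 < \<rho>" "\<rho> < 1"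
    using eventually_happens trivial_limit_at_left_real[of "1::real"] by fastforce
  let ?f = "\<lambda>n. sawtooth (real n * \<alpha>) * sin (2 * pi * (n * \<theta>))"
  let ?g = "\<lambda>n. sawtooth_abel \<rho> (real n * \<alpha>) * sin (2 * pi * (n * \<theta>))"
  let ?B = "\<lambda>N. {n\<in>{..<N}. frac (real n * \<alpha>) \<notin> {\<delta>..1 - \<delta>}}"
  have term_le: "\<bar>?f n - ?g n\<bar> \<le> \<epsilon> / 2 + 2 * of_bool (frac (real n * \<alpha>) \<notin> {\<delta>..1 - \<delta>})" for n
  proof -
    have "\<bar>?f n - ?g n\<bar> = \<bar>sawtooth (n * \<alpha>) - sawtooth_abel \<rho> (n * \<alpha>)\<bar> * \<bar>sin (2 * pi * (n * \<theta>))\<bar>"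
      by (simp add: left_diff_distrib flip: abs_mult)
    also have "\<dots> \<le> \<bar>sawtooth (n * \<alpha>) - sawtooth_abel \<rho> (n * \<alpha>)\<bar>"
      by (intro mult_right_le_one_le) auto
    also have "\<dots> \<le> \<epsilon> / 2 + 2 * of_bool (frac (real n * \<alpha>) \<notin> {\<delta>..1 - \<delta>})"
    proof (cases "frac (real n * \<alpha>) \<in> {\<delta>..1 - \<delta>}")
      case True
      with \<rho>(2) have "\<bar>sawtooth_abel \<rho> (frac (n * \<alpha>)) - (frac (n * \<alpha>) - 1 / 2)\<bar> \<le> \<epsilon> / 2"
        by blast
      then show ?thesis using True
        by (simp add: sawtooth_abel_frac sawtooth_def abs_minus_commute)
    next
      case False
      moreover have "\<bar>sawtooth_abel \<rho> (n * \<alpha>)\<bar> \<le> 1"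
        using \<rho> by (intro abs_sawtooth_abel_le) auto
      ultimately show ?thesis using abs_sawtooth_le[of "n * \<alpha>"] \<open>\<epsilon> > 0\<close> by simp
    qed
    finally show ?thesis .
  qed
  have "\<forall>\<^sub>F N in sequentially. (\<Sum>n<N. \<bar>?f n - ?g n\<bar>) \<le> \<epsilon> * real N"
    using sparse
  proof eventually_elim
    case (elim N)
    have "(\<Sum>n<N. \<bar>?f n - ?g n\<bar>) \<le>
        (\<Sum>n<N. \<epsilon> / 2 + 2 * of_bool (frac (real n * \<alpha>) \<notin> {\<delta>..1 - \<delta>}))"
      by (intro sum_mono term_le)
    also have "\<dots> = \<epsilon> / 2 * N + 2 * card (?B N)"
    proof -
      have "(\<Sum>n<N. of_bool (frac (real n * \<alpha>) \<notin> {\<delta>..1 - \<delta>})) = real (card (?B N))"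
        by (simp add: sum_of_bool_eq Int_def del: atLeastAtMost_iff)
      then show ?thesis by (simp add: sum.distrib flip: sum_distrib_left)
    qed
    also have "\<dots> \<le> \<epsilon> * N" using elim by (simp add: field_simps)
    finally show ?case .
  qed
  then show "\<exists>g e. has_mean g e \<and> \<bar>e - c\<bar> \<le> \<epsilon> \<and>
     (\<forall>\<^sub>F N in sequentially. (\<Sum>n<N. \<bar>?f n - g n\<bar>) \<le> \<epsilon> * real N)"
    using has_mean_sawtooth_abel_sin[of \<rho> \<alpha> \<theta>] \<rho> less_imp_le by blast
qed

lemma has_mean_sawtooth_sin_nonresonant:
  fixes \<alpha> \<theta> :: real
  assumes "\<alpha> \<notin> \<rat>" and "\<And>k::int. k \<noteq> 0 \<Longrightarrow> k * \<alpha> - \<theta> \<notin> \<int>"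
  shows "has_mean (\<lambda>n. sawtooth (n * \<alpha>) * sin (2 * pi * (n * \<theta>))) 0"
proof (rule has_mean_sawtooth_sin)
  have vals: "resonant_term \<rho> \<alpha> \<theta> k = 0"
    for \<rho> :: real and k :: nat
  proof (cases "k = 0")
    case False
    have "- (k * \<alpha> + \<theta>) \<notin> \<int>" using assms(2)[of "- int k"] False by simp
    then have "k * \<alpha> + \<theta> \<notin> \<int>" by (simp only: minus_in_Ints_iff) simp
    then show ?thesis using assms(2)[of "int k"] False by (simp add: resonant_term_def)
  qed (simp add: resonant_term_def)
  have "resonant_term \<rho> \<alpha> \<theta> = (\<lambda>_. 0)" for \<rho>
    by (rule ext) (rule vals)
  then show "((\<lambda>\<rho>. suminf (resonant_term \<rho> \<alpha> \<theta>)) \<longlongrightarrow> 0) (at_left 1)"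
    by (simp only: suminf_zero tendsto_const)
qed fact

lemma irrational_resonance_unique:
  fixes \<alpha> \<theta> :: real and j k :: int
  assumes "\<alpha> \<notin> \<rat>" "j * \<alpha> - \<theta> \<in> \<int>" "k * \<alpha> - \<theta> \<in> \<int>"
  shows "j = k"
proof (rule ccontr)
  assume "j \<noteq> k"
  have "(j * \<alpha> - \<theta>) - (k * \<alpha> - \<theta>) \<in> \<int>" using assms(2,3) by (rule Ints_diff)
  then obtain m :: int where "(j * \<alpha> - \<theta>) - (k * \<alpha> - \<theta>) = m" by (elim Ints_cases)
  then have "\<alpha> = of_int m / of_int (j - k)" using \<open>j \<noteq> k\<close> by (simp add: field_simps)
  then show False using assms(1) by (metis Rats_divide Rats_of_int)
qed

text \<open>
  Irrationality makes \<open>j\<close> the only resonant frequency, so the series reduces to its term with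
  \<open>k = |j|\<close>. For \<open>j < 0\<close> it is the indicator with \<open>+ \<theta>\<close> that survives, and its minus sign turns
  \<open>1/|j|\<close> into \<open>1/j\<close>.
\<close>

lemma has_mean_sawtooth_sin_resonant:
  fixes \<alpha> \<theta> :: real and j :: int
  assumes irr: "\<alpha> \<notin> \<rat>" and "j \<noteq> 0" and res: "j * \<alpha> - \<theta> \<in> \<int>"
  shows "has_mean (\<lambda>n. sawtooth (n * \<alpha>) * sin (2 * pi * (n * \<theta>))) (- 1 / (2 * pi * j))"
proof (rule has_mean_sawtooth_sin[OF irr])
  define J where "J = nat \<bar>j\<bar>"
  have vals: "resonant_term \<rho> \<alpha> \<theta> k =
      (if k = J then - (\<rho> ^ J) / (2 * pi * j) else 0)"
    for \<rho> :: real and k :: nat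
  proof (cases "k = 0")
    case False
    have p: "k * \<alpha> - \<theta> \<in> \<int> \<longleftrightarrow> int k = j"
      using irrational_resonance_unique[OF irr res, of "int k"] res by auto
    have "k * \<alpha> + \<theta> \<in> \<int> \<longleftrightarrow> of_int (- int k) * \<alpha> - \<theta> \<in> \<int>"
      using minus_in_Ints_iff[of "k * \<alpha> + \<theta>"] by simp
    also have "\<dots> \<longleftrightarrow> - int k = j"
      using irrational_resonance_unique[OF irr res, of "- int k"] res by auto
    finally have q: "k * \<alpha> + \<theta> \<in> \<int> \<longleftrightarrow> - int k = j" .
    consider "int k = j" | "- int k = j" | "k \<noteq> J" unfolding J_def by linarith
    then show ?thesis
    proof cases
      case 1
      then show ?thesis using False unfolding resonant_term_def p q J_def by auto
    next
      case 2
      then show ?thesis using False unfolding resonant_term_def p q J_def by auto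
    next
      case 3
      then show ?thesis unfolding resonant_term_def p q J_def by auto
    qed
  qed (use \<open>j \<noteq> 0\<close> in \<open>auto simp: J_def resonant_term_def\<close>)
  have "resonant_term \<rho> \<alpha> \<theta> = (\<lambda>k. if k = J then - (\<rho> ^ J) / (2 * pi * j) else 0)" for \<rho>
    by (rule ext) (rule vals)
  moreover have "((\<lambda>\<rho>::real. - (\<rho> ^ J) / (2 * pi * j)) \<longlongrightarrow> - (1 ^ J) / (2 * pi * j)) (at_left 1)"
    using \<open>j \<noteq> 0\<close> by (intro tendsto_intros) auto
  ultimately show "((\<lambda>\<rho>. suminf (resonant_term \<rho> \<alpha> \<theta>))
      \<longlongrightarrow> - 1 / (2 * pi * j)) (at_left 1)"
    by (simp only: sums_unique[OF sums_single, symmetric] power_one)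
qed

section \<open>Positive amplitudes are determined by a sum of fractional parts\<close>

text \<open>
  With at least two indices this says that \<open>1, x\<^sub>i, x\<^sub>j\<close> are linearly independent over \<open>\<rat>\<close> for all
  \<open>i \<noteq> j\<close>. Since each sawtooth depends on one of the numbers only, no other relations matter.
\<close>

definition pairwise_independent_mod_Ints :: "'i set \<Rightarrow> ('i \<Rightarrow> real) \<Rightarrow> bool" where
  "pairwise_independent_mod_Ints I x \<longleftrightarrow> (\<forall>i\<in>I. x i \<notin> \<rat>) \<and>
     (\<forall>i\<in>I. \<forall>j\<in>I. i \<noteq> j \<longrightarrow>
        (\<forall>k l::int. of_int k * x i + of_int l * x j \<in> \<int> \<longrightarrow> k = 0 \<and> l = 0))"

text \<open>
  Average against \<open>sin (2\<pi>n\<alpha>\<^sub>p)\<close>. The mean vanishes since the sequence converges, while by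
  independence the terms with \<open>\<alpha>\<close> contribute just \<open>- a\<^sub>p / (2\<pi>)\<close>. Some \<open>\<beta>\<^sub>q\<close> must compensate for this,
  only one can be in resonance with \<open>\<alpha>\<^sub>p\<close>, and its contribution is \<open>- b\<^sub>q / (2\<pi>k)\<close>.
  The sign of \<open>k\<close> is that of \<open>b\<^sub>q / a\<^sub>p\<close>.
\<close>

lemma resonance_partner_exists:
  fixes \<alpha> \<beta> a b :: "'i \<Rightarrow> real"
  assumes "finite I" and pos: "\<And>i. i \<in> I \<Longrightarrow> a i > 0" "\<And>i. i \<in> I \<Longrightarrow> b i > 0"
    and \<alpha>: "pairwise_independent_mod_Ints I \<alpha>" and \<beta>: "pairwise_independent_mod_Ints I \<beta>"
    and lim: "(\<lambda>n. (\<Sum>i\<in>I. a i * sawtooth (n * \<alpha> i)) - (\<Sum>i\<in>I. b i * sawtooth (n * \<beta> i))) \<longlonglongrightarrow> C"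
    and "p \<in> I"
  shows "\<exists>q\<in>I. \<exists>k::int. k \<ge> 1 \<and> of_int k * \<beta> q - \<alpha> p \<in> \<int> \<and> b q = of_int k * a p"
proof -
  define \<theta> where "\<theta> = \<alpha> p"
  define s where "s = (\<lambda>n::nat. sin (2 * pi * (n * \<theta>)))"
  define F where "F = (\<lambda>n::nat. (\<Sum>i\<in>I. a i * sawtooth (n * \<alpha> i)) - (\<Sum>i\<in>I. b i * sawtooth (n * \<beta> i)))"
  have mean0: "has_mean (\<lambda>n. F n * s n) 0"
  proof -
    have "(\<lambda>n. F n - C) \<longlonglongrightarrow> 0" using lim by (simp add: F_def LIM_zero)
    then have "(\<lambda>n. s n * (F n - C)) \<longlonglongrightarrow> 0"
      by (rule Lim_null_comparison[rotated, OF tendsto_norm_zero])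
        (auto simp: s_def abs_mult mult_left_le_one_le)
    then have "has_mean (\<lambda>n. s n * (F n - C)) 0" by (rule has_mean_if_tendsto)
    moreover have "has_mean (\<lambda>n. (- C) * s n) ((- C) * 0)"
      unfolding s_def by (intro has_mean_cmult has_mean_sin)
    ultimately have "has_mean (\<lambda>n. s n * (F n - C) - (- C) * s n) (0 - (- C) * 0)"
      by (rule has_mean_diff)
    then show ?thesis by (simp add: algebra_simps)
  qed
  have meanF: "(\<Sum>i\<in>I. a i * c i) = (\<Sum>i\<in>I. b i * e i)"
    if "\<And>i. i \<in> I \<Longrightarrow> has_mean (\<lambda>n. sawtooth (n * \<alpha> i) * s n) (c i)"
      "\<And>i. i \<in> I \<Longrightarrow> has_mean (\<lambda>n. sawtooth (n * \<beta> i) * s n) (e i)" for c e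
  proof -
    have "has_mean (\<lambda>n. (\<Sum>i\<in>I. a i * (sawtooth (n * \<alpha> i) * s n)) -
        (\<Sum>i\<in>I. b i * (sawtooth (n * \<beta> i) * s n))) ((\<Sum>i\<in>I. a i * c i) - (\<Sum>i\<in>I. b i * e i))"
      using that by (intro has_mean_diff has_mean_sum has_mean_cmult)
    moreover have "(\<lambda>n. (\<Sum>i\<in>I. a i * (sawtooth (n * \<alpha> i) * s n)) -
        (\<Sum>i\<in>I. b i * (sawtooth (n * \<beta> i) * s n))) = (\<lambda>n. F n * s n)"
      by (simp add: F_def left_diff_distrib sum_distrib_right mult.assoc)
    ultimately have "has_mean (\<lambda>n. F n * s n) ((\<Sum>i\<in>I. a i * c i) - (\<Sum>i\<in>I. b i * e i))"
      by (simp only:)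
    from has_mean_unique[OF mean0 this] show ?thesis by simp
  qed
  \<comment> \<open>The means against \<open>s\<close> of the individual sawtooth terms are \<open>c\<close> for \<open>\<alpha>\<close> and, below, \<open>e\<close> for \<open>\<beta>\<close>.\<close>
  define c where "c = (\<lambda>i. if i = p then - 1 / (2 * pi) else (0::real))"
  have c: "has_mean (\<lambda>n. sawtooth (n * \<alpha> i) * s n) (c i)" if "i \<in> I" for i
  proof (cases "i = p")
    case True
    then show ?thesis
      using has_mean_sawtooth_sin_resonant[of "\<alpha> p" 1 \<theta>] \<alpha> that
      by (simp add: c_def s_def \<theta>_def pairwise_independent_mod_Ints_def)
  next
    case False
    have "of_int k * \<alpha> i - \<theta> \<notin> \<int>" if "k \<noteq> 0" for k :: int
    proof
      assume "of_int k * \<alpha> i - \<theta> \<in> \<int>"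
      then have "of_int k * \<alpha> i + of_int (- 1) * \<alpha> p \<in> \<int>" by (simp add: \<theta>_def)
      then show False using \<alpha> False \<open>i \<in> I\<close> \<open>p \<in> I\<close> that
        unfolding pairwise_independent_mod_Ints_def by blast
    qed
    then show ?thesis
      using has_mean_sawtooth_sin_nonresonant[of "\<alpha> i" \<theta>] \<alpha> that False
      by (simp add: c_def s_def pairwise_independent_mod_Ints_def)
  qed
  have sum_c: "(\<Sum>i\<in>I. a i * c i) = - a p / (2 * pi)"
  proof -
    have "(\<Sum>i\<in>I. a i * c i) = (\<Sum>i\<in>I. if i = p then - a p / (2 * pi) else 0)"
      by (intro sum.cong) (auto simp: c_def)
    then show ?thesis using \<open>finite I\<close> \<open>p \<in> I\<close> by simp
  qed
  have \<beta>_irr: "\<beta> i \<notin> \<rat>" if "i \<in> I" for i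
    using \<beta> that by (simp add: pairwise_independent_mod_Ints_def)
  have "\<exists>q\<in>I. \<exists>k::int. k \<noteq> 0 \<and> of_int k * \<beta> q - \<theta> \<in> \<int>"
  proof (rule ccontr)
    assume "\<not> ?thesis"
    then have "has_mean (\<lambda>n. sawtooth (n * \<beta> i) * s n) 0" if "i \<in> I" for i
      using that \<beta>_irr unfolding s_def by (intro has_mean_sawtooth_sin_nonresonant) auto
    with meanF[OF c, of "\<lambda>_. 0"] sum_c have "a p = 0" by simp
    with pos(1)[OF \<open>p \<in> I\<close>] show False by simp
  qed
  then obtain q k where q: "q \<in> I" "k \<noteq> 0" "of_int k * \<beta> q - \<theta> \<in> \<int>" by blast
  define e where "e = (\<lambda>i. if i = q then - 1 / (2 * pi * of_int k) else (0::real))"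
  have e: "has_mean (\<lambda>n. sawtooth (n * \<beta> i) * s n) (e i)" if "i \<in> I" for i
  proof (cases "i = q")
    case True
    then show ?thesis
      using has_mean_sawtooth_sin_resonant[of "\<beta> q" k \<theta>] q \<beta>_irr by (simp add: e_def s_def)
  next
    case False
    have "of_int l * \<beta> i - \<theta> \<notin> \<int>" if "l \<noteq> 0" for l :: int
    proof
      assume "of_int l * \<beta> i - \<theta> \<in> \<int>"
      then have "(of_int l * \<beta> i - \<theta>) - (of_int k * \<beta> q - \<theta>) \<in> \<int>" using q(3) by (rule Ints_diff)
      then have "of_int l * \<beta> i + of_int (- k) * \<beta> q \<in> \<int>" by simp
      then show False using \<beta> False \<open>i \<in> I\<close> \<open>q \<in> I\<close> that
        unfolding pairwise_independent_mod_Ints_def by blast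
    qed
    then show ?thesis
      using has_mean_sawtooth_sin_nonresonant[of "\<beta> i" \<theta>] \<beta>_irr that False
      by (simp add: e_def s_def)
  qed
  have "(\<Sum>i\<in>I. b i * e i) = - b q / (2 * pi * of_int k)"
  proof -
    have "(\<Sum>i\<in>I. b i * e i) = (\<Sum>i\<in>I. if i = q then - b q / (2 * pi * of_int k) else 0)"
      by (intro sum.cong) (auto simp: e_def)
    then show ?thesis using \<open>finite I\<close> \<open>q \<in> I\<close> by simp
  qed
  with meanF[OF c e] sum_c have eq: "b q = of_int k * a p"
    using \<open>k \<noteq> 0\<close> by (simp add: field_simps)
  with pos(1)[OF \<open>p \<in> I\<close>] pos(2)[OF \<open>q \<in> I\<close>] have "k > 0"
    by (simp add: zero_less_mult_iff)
  then show ?thesis using q eq by (intro bexI[of _ q] exI[of _ k]) (auto simp: \<theta>_def)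
qed

text \<open>
  If \<open>\<alpha>\<^sub>i\<close> and \<open>\<alpha>\<^sub>j\<close> had the same partner, both would be congruent to multiples of one number,
  and eliminating that number would relate \<open>\<alpha>\<^sub>i\<close> and \<open>\<alpha>\<^sub>j\<close>. So the choice of partners is injective.
\<close>

lemma dominating_bijection_exists:
  fixes \<alpha> \<beta> a b :: "'i \<Rightarrow> real"
  assumes "finite I" and pos: "\<And>i. i \<in> I \<Longrightarrow> a i > 0" "\<And>i. i \<in> I \<Longrightarrow> b i > 0"
    and \<alpha>: "pairwise_independent_mod_Ints I \<alpha>" and \<beta>: "pairwise_independent_mod_Ints I \<beta>"
    and lim: "(\<lambda>n. (\<Sum>i\<in>I. a i * sawtooth (n * \<alpha> i)) - (\<Sum>i\<in>I. b i * sawtooth (n * \<beta> i))) \<longlonglongrightarrow> C"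
  obtains \<sigma> where "bij_betw \<sigma> I I" "\<And>i. i \<in> I \<Longrightarrow> a i \<le> b (\<sigma> i)"
proof -
  have "\<forall>p\<in>I. \<exists>q. q \<in> I \<and> (\<exists>k::int. k \<ge> 1 \<and> of_int k * \<beta> q - \<alpha> p \<in> \<int> \<and> b q = of_int k * a p)"
    using resonance_partner_exists[OF assms] by blast
  from bchoice[OF this] obtain \<sigma> where "\<forall>p\<in>I. \<sigma> p \<in> I \<and>
      (\<exists>k::int. k \<ge> 1 \<and> of_int k * \<beta> (\<sigma> p) - \<alpha> p \<in> \<int> \<and> b (\<sigma> p) = of_int k * a p)" ..
  then have "\<forall>p\<in>I. \<exists>k::int. \<sigma> p \<in> I \<and> k \<ge> 1 \<and>
      of_int k * \<beta> (\<sigma> p) - \<alpha> p \<in> \<int> \<and> b (\<sigma> p) = of_int k * a p" by blast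
  from bchoice[OF this] obtain k where \<sigma>: "\<And>p. p \<in> I \<Longrightarrow> \<sigma> p \<in> I \<and> (k p :: int) \<ge> 1 \<and>
      of_int (k p) * \<beta> (\<sigma> p) - \<alpha> p \<in> \<int> \<and> b (\<sigma> p) = of_int (k p) * a p"
    by blast
  have "inj_on \<sigma> I"
  proof (rule inj_onI, rule ccontr)
    fix i j assume ij: "i \<in> I" "j \<in> I" "\<sigma> i = \<sigma> j" "i \<noteq> j"
    have "of_int (k i) * (of_int (k j) * \<beta> (\<sigma> j) - \<alpha> j) - of_int (k j) * (of_int (k i) * \<beta> (\<sigma> i) - \<alpha> i) \<in> \<int>"
      using \<sigma>[OF ij(1)] \<sigma>[OF ij(2)] by (intro Ints_diff[OF Ints_mult Ints_mult] Ints_of_int) blast+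
    also have "of_int (k i) * (of_int (k j) * \<beta> (\<sigma> j) - \<alpha> j) - of_int (k j) * (of_int (k i) * \<beta> (\<sigma> i) - \<alpha> i)
        = of_int (k j) * \<alpha> i + of_int (- k i) * \<alpha> j"
      unfolding ij(3) by (simp add: algebra_simps)
    finally have "of_int (k j) * \<alpha> i + of_int (- k i) * \<alpha> j \<in> \<int>" .
    then have "k j = 0" using \<alpha> ij unfolding pairwise_independent_mod_Ints_def by blast
    with \<sigma>[OF ij(2)] show False by simp
  qed
  moreover have "\<sigma> ` I \<subseteq> I" using \<sigma> by blast
  ultimately have "bij_betw \<sigma> I I"
    using \<open>finite I\<close> by (simp add: bij_betw_def endo_inj_surj)
  moreover have "a i \<le> b (\<sigma> i)" if "i \<in> I" for i
  proof -
    have "1 * a i \<le> of_int (k i) * a i"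
      using \<sigma>[OF that] pos(1)[OF that] by (intro mult_right_mono) auto
    then show ?thesis using \<sigma>[OF that] by simp
  qed
  ultimately show thesis by (rule that)
qed

text \<open>
  Bijections in both directions dominate, so \<open>\<Sum> a = \<Sum> b\<close>, and a termwise inequality between equal
  finite sums is an equality in every term.
\<close>

theorem amplitudes_match:
  fixes \<alpha> \<beta> a b :: "'i \<Rightarrow> real"
  assumes "finite I" and pos: "\<And>i. i \<in> I \<Longrightarrow> a i > 0" "\<And>i. i \<in> I \<Longrightarrow> b i > 0"
    and \<alpha>: "pairwise_independent_mod_Ints I \<alpha>" and \<beta>: "pairwise_independent_mod_Ints I \<beta>"
    and lim: "(\<lambda>n. (\<Sum>i\<in>I. a i * frac (n * \<alpha> i)) - (\<Sum>i\<in>I. b i * frac (n * \<beta> i))) \<longlonglongrightarrow> C"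
  obtains \<sigma> where "bij_betw \<sigma> I I" "\<And>i. i \<in> I \<Longrightarrow> a i = b (\<sigma> i)"
proof -
  let ?F = "\<lambda>n::nat. (\<Sum>i\<in>I. a i * sawtooth (n * \<alpha> i)) - (\<Sum>i\<in>I. b i * sawtooth (n * \<beta> i))"
  define C' where "C' = C - (\<Sum>i\<in>I. a i / 2) + (\<Sum>i\<in>I. b i / 2)"
  have "?F = (\<lambda>n. (\<Sum>i\<in>I. a i * frac (n * \<alpha> i)) - (\<Sum>i\<in>I. b i * frac (n * \<beta> i))
       - (\<Sum>i\<in>I. a i / 2) + (\<Sum>i\<in>I. b i / 2))"
    by (simp add: fun_eq_iff sawtooth_def right_diff_distrib sum_subtractf)
  then have F: "?F \<longlonglongrightarrow> C'"
    unfolding C'_def using lim by (simp only:) (intro tendsto_add tendsto_diff[OF _ tendsto_const] tendsto_const)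
  then have F': "(\<lambda>n. (\<Sum>i\<in>I. b i * sawtooth (n * \<beta> i)) - (\<Sum>i\<in>I. a i * sawtooth (n * \<alpha> i))) \<longlonglongrightarrow> - C'"
    using tendsto_minus[OF F] by simp
  obtain \<sigma> where \<sigma>: "bij_betw \<sigma> I I" "\<And>i. i \<in> I \<Longrightarrow> a i \<le> b (\<sigma> i)"
    using dominating_bijection_exists[OF \<open>finite I\<close> pos \<alpha> \<beta> F] by blast
  obtain \<tau> where \<tau>: "bij_betw \<tau> I I" "\<And>i. i \<in> I \<Longrightarrow> b i \<le> a (\<tau> i)"
    using dominating_bijection_exists[OF \<open>finite I\<close> pos(2,1) \<beta> \<alpha> F'] by blast
  have "(\<Sum>i\<in>I. b (\<sigma> i)) = (\<Sum>i\<in>I. b i)" using \<sigma>(1) by (rule sum.reindex_bij_betw)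
  also have "\<dots> \<le> (\<Sum>i\<in>I. a (\<tau> i))" using \<tau>(2) by (rule sum_mono)
  also have "\<dots> = (\<Sum>i\<in>I. a i)" using \<tau>(1) by (rule sum.reindex_bij_betw)
  finally have "(\<Sum>i\<in>I. b (\<sigma> i) - a i) \<le> 0" by (simp add: sum_subtractf)
  moreover have "(\<Sum>i\<in>I. b (\<sigma> i) - a i) \<ge> 0" using \<sigma>(2) by (intro sum_nonneg) auto
  ultimately have "(\<Sum>i\<in>I. b (\<sigma> i) - a i) = 0" by simp
  then have "\<forall>i\<in>I. b (\<sigma> i) - a i = 0"
    using \<sigma>(2) \<open>finite I\<close> by (subst (asm) sum_nonneg_eq_0_iff) auto
  then show thesis using that[OF \<sigma>(1)] by simp
qed

section \<open>Expansions to first order\<close>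

text \<open>
  The relation \<open>t n = s - u n / n + o(1/n)\<close>. The correction \<open>u\<close> is a bounded sequence rather than a
  number because the fractional parts in it oscillate.
\<close>

definition first_order :: "(nat \<Rightarrow> real) \<Rightarrow> real \<Rightarrow> (nat \<Rightarrow> real) \<Rightarrow> bool" where
  "first_order t s u \<longleftrightarrow> Bseq u \<and> (\<lambda>n. real n * (t n - s) + u n) \<longlonglongrightarrow> 0"

lemma Bseq_over_n_tendsto_0:
  fixes v :: "nat \<Rightarrow> real"
  assumes "Bseq v" shows "(\<lambda>n. v n / n) \<longlonglongrightarrow> 0"
proof -
  have "(\<lambda>n. 1 / real n) \<longlonglongrightarrow> 0" by (rule lim_const_over_n)
  then have "Zfun (\<lambda>n. 1 / real n) sequentially" by (simp add: tendsto_Zfun_iff)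
  then have "Zfun (\<lambda>n. 1 / real n * v n) sequentially"
    using assms by (rule bounded_bilinear.Zfun_prod_Bfun[OF bounded_bilinear_mult])
  then show ?thesis by (simp add: tendsto_Zfun_iff)
qed

lemma Bseq_add_Bseq:
  fixes f g :: "nat \<Rightarrow> real"
  assumes "Bseq f" "Bseq g" shows "Bseq (\<lambda>n. f n + g n)"
proof -
  obtain K L where "\<And>n. \<bar>f n\<bar> \<le> K" "\<And>n. \<bar>g n\<bar> \<le> L"
    using assms by (auto simp: Bseq_def)
  then have "norm (f n + g n) \<le> K + L" for n
    by (metis abs_triangle_ineq add_mono order_trans real_norm_def)
  then show ?thesis by (rule BseqI')
qed

lemma first_order_Bseq:
  assumes "first_order t s u" shows "Bseq (\<lambda>n. real n * (t n - s))"
proof -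
  have "Bseq (\<lambda>n. real n * (t n - s) + u n)"
    using assms by (intro convergent_imp_Bseq) (auto simp: first_order_def convergent_def)
  moreover have "Bseq (\<lambda>n. - u n)" using assms by (simp add: first_order_def Bseq_minus_iff)
  ultimately have "Bseq (\<lambda>n. (real n * (t n - s) + u n) + - u n)" by (rule Bseq_add_Bseq)
  then show ?thesis by simp
qed

lemma first_order_tendsto:
  assumes "first_order t s u" shows "t \<longlonglongrightarrow> s"
proof -
  have "(\<lambda>n. (real n * (t n - s)) / n) \<longlonglongrightarrow> 0"
    by (intro Bseq_over_n_tendsto_0 first_order_Bseq[OF assms])
  moreover have "\<forall>\<^sub>F n in sequentially. (real n * (t n - s)) / n = t n - s"
    using eventually_gt_at_top[of 0] by eventually_elim auto
  ultimately have "(\<lambda>n. t n - s) \<longlonglongrightarrow> 0" by (rule Lim_transform_eventually)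
  then show ?thesis by (rule LIM_zero_cancel)
qed

lemma first_order_const: "first_order (\<lambda>_. c) c (\<lambda>_. 0)"
  by (simp add: first_order_def)

lemma first_order_add:
  assumes "first_order t s u" "first_order t' s' u'"
  shows "first_order (\<lambda>n. t n + t' n) (s + s') (\<lambda>n. u n + u' n)"
proof -
  have "(\<lambda>n. (real n * (t n - s) + u n) + (real n * (t' n - s') + u' n)) \<longlonglongrightarrow> 0 + 0"
    using assms unfolding first_order_def by (intro tendsto_add) auto
  moreover have "Bseq (\<lambda>n. u n + u' n)"
    using assms unfolding first_order_def by (intro Bseq_add_Bseq) auto
  ultimately show ?thesis by (simp add: first_order_def algebra_simps)
qed

text \<open>
  The product rule; the cross term \<open>n (t n - s) (t' n - s')\<close> is a bounded sequence times a null sequence.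
\<close>

lemma first_order_mult:
  assumes "first_order t s u" "first_order t' s' u'"
  shows "first_order (\<lambda>n. t n * t' n) (s * s') (\<lambda>n. s' * u n + s * u' n)"
proof -
  have Z: "(\<lambda>n. t' n - s') \<longlonglongrightarrow> 0" using first_order_tendsto[OF assms(2)] by (rule LIM_zero)
  have "(\<lambda>n. (real n * (t n - s)) * (t' n - s')) \<longlonglongrightarrow> 0"
    using bounded_bilinear.Bfun_prod_Zfun[OF bounded_bilinear_mult, OF first_order_Bseq[OF assms(1)]] Z
    by (simp add: tendsto_Zfun_iff)
  then have "(\<lambda>n. (real n * (t n - s)) * (t' n - s') + s' * (real n * (t n - s) + u n) + s * (real n * (t' n - s') + u' n))
      \<longlonglongrightarrow> 0 + s' * 0 + s * 0"
    using assms unfolding first_order_def by (intro tendsto_add tendsto_mult_left) auto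
  moreover have "Bseq (\<lambda>n. s' * u n + s * u' n)"
    using assms unfolding first_order_def by (intro Bseq_add_Bseq Bseq_mult Bfun_const) auto
  ultimately show ?thesis by (simp add: first_order_def algebra_simps)
qed

lemma first_order_cmult:
  assumes "first_order t s u" shows "first_order (\<lambda>n. c * t n) (c * s) (\<lambda>n. c * u n)"
  using first_order_mult[OF first_order_const[of c] assms] by simp

lemma first_order_sum:
  assumes "finite I" "\<And>i. i \<in> I \<Longrightarrow> first_order (t i) (s i) (u i)"
  shows "first_order (\<lambda>n. \<Sum>i\<in>I. t i n) (\<Sum>i\<in>I. s i) (\<lambda>n. \<Sum>i\<in>I. u i n)"
  using assms by (induction rule: finite_induct) (auto intro: first_order_const first_order_add)

lemma first_order_prod:
  assumes "finite I" "\<And>i. i \<in> I \<Longrightarrow> first_order (t i) (s i) (u i)"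
  shows "first_order (\<lambda>n. \<Prod>i\<in>I. t i n) (\<Prod>i\<in>I. s i) (\<lambda>n. \<Sum>i\<in>I. (\<Prod>j\<in>I - {i}. s j) * u i n)"
  using assms
proof (induction rule: finite_induct)
  case (insert p I)
  have "(\<Prod>i\<in>I. s i) * u p n + s p * (\<Sum>i\<in>I. (\<Prod>j\<in>I - {i}. s j) * u i n)
      = (\<Sum>i\<in>insert p I. (\<Prod>j\<in>insert p I - {i}. s j) * u i n)" for n
  proof -
    have "(\<Prod>j\<in>insert p I - {i}. s j) = s p * (\<Prod>j\<in>I - {i}. s j)" if "i \<in> I" for i
    proof -
      have "insert p I - {i} = insert p (I - {i})" using that insert.hyps by auto
      then show ?thesis using insert.hyps by simp
    qed
    then have "s p * (\<Sum>i\<in>I. (\<Prod>j\<in>I - {i}. s j) * u i n)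
        = (\<Sum>i\<in>I. (\<Prod>j\<in>insert p I - {i}. s j) * u i n)"
      by (simp add: sum_distrib_left mult.assoc)
    moreover have "insert p I - {p} = I" using insert.hyps by auto
    ultimately show ?thesis using insert.hyps by simp
  qed
  then show ?case
    using first_order_mult[of "t p" "s p" "u p", OF _ insert.IH] insert.prems insert.hyps by simp
qed (simp add: first_order_const)

lemma first_order_power:
  assumes "first_order t s u"
  shows "first_order (\<lambda>n. t n ^ r) (s ^ r) (\<lambda>n. of_nat r * s ^ (r - 1) * u n)"
proof (induction r)
  case (Suc r)
  have "s ^ r * u n + s * (of_nat r * s ^ (r - 1) * u n) = of_nat (Suc r) * s ^ (Suc r - 1) * u n" for n
    by (cases r) (auto simp: algebra_simps)
  then show ?case using first_order_mult[OF assms Suc] by simp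
qed (simp add: first_order_const)

text \<open>
  Here the error term vanishes: \<open>\<lfloor>nx\<rfloor> = nx - {nx}\<close>.
\<close>

lemma first_order_floor:
  fixes x :: real
  shows "first_order (\<lambda>n. of_int \<lfloor>n * x\<rfloor> / n) x (\<lambda>n. frac (real n * x))"
proof -
  have "\<forall>\<^sub>F n in sequentially. 0 = real n * (of_int \<lfloor>n * x\<rfloor> / n - x) + frac (real n * x)"
    using eventually_gt_at_top[of 0] by eventually_elim (simp add: frac_def field_simps)
  then have "(\<lambda>n. real n * (of_int \<lfloor>n * x\<rfloor> / n - x) + frac (real n * x)) \<longlonglongrightarrow> 0"
    by (rule Lim_transform_eventually[OF tendsto_const])
  moreover have "Bseq (\<lambda>n. frac (real n * x))"
    by (rule BseqI'[of _ 1]) (auto simp: less_imp_le[OF frac_lt_1])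
  ultimately show ?thesis by (simp add: first_order_def)
qed

lemma first_order_perturb:
  assumes "first_order t s u" "(\<lambda>n. real n * w n) \<longlonglongrightarrow> c"
  shows "first_order (\<lambda>n. t n + w n) s (\<lambda>n. u n - c)"
proof -
  have "(\<lambda>n. (real n * (t n - s) + u n) + (real n * w n - c)) \<longlonglongrightarrow> 0 + 0"
    using assms unfolding first_order_def by (intro tendsto_add LIM_zero) auto
  moreover have "Bseq (\<lambda>n. u n + - c)"
    using assms unfolding first_order_def by (intro Bseq_add) auto
  ultimately show ?thesis by (simp add: first_order_def algebra_simps)
qed

lemma first_order_unique:
  assumes "first_order t s u" "first_order t' s' u'" "\<forall>\<^sub>F n in sequentially. t n = t' n"
  shows "s = s'" "(\<lambda>n. u n - u' n) \<longlonglongrightarrow> 0"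
proof -
  have "t' \<longlonglongrightarrow> s"
    using first_order_tendsto[OF assms(1)] assms(3) by (rule Lim_transform_eventually)
  then show eq: "s = s'" using first_order_tendsto[OF assms(2)] by (rule LIMSEQ_unique)
  have "(\<lambda>n. (real n * (t n - s) + u n) - (real n * (t' n - s') + u' n)) \<longlonglongrightarrow> 0 - 0"
    using assms unfolding first_order_def by (intro tendsto_diff) auto
  then have "(\<lambda>n. (real n * (t n - s) + u n) - (real n * (t' n - s') + u' n)) \<longlonglongrightarrow> 0" by simp
  moreover have "\<forall>\<^sub>F n in sequentially. (real n * (t n - s) + u n) - (real n * (t' n - s') + u' n) = u n - u' n"
    using assms(3) by eventually_elim (simp add: eq)
  ultimately show "(\<lambda>n. u n - u' n) \<longlonglongrightarrow> 0" by (rule Lim_transform_eventually)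
qed

section \<open>Evaluation and total degree\<close>

definition monom_eval :: "(nat \<Rightarrow> real) \<Rightarrow> (nat \<Rightarrow>\<^sub>0 nat) \<Rightarrow> real" where
  "monom_eval \<xi> m = (\<Prod>i\<in>Poly_Mapping.keys m. \<xi> i ^ Poly_Mapping.lookup m i)"

lemma monom_eval_superset:
  assumes "finite A" "Poly_Mapping.keys m \<subseteq> A"
  shows "monom_eval \<xi> m = (\<Prod>i\<in>A. \<xi> i ^ Poly_Mapping.lookup m i)"
  unfolding monom_eval_def using assms by (intro prod.mono_neutral_left) (auto simp: in_keys_iff)

lemma monom_eval_add: "monom_eval \<xi> (a + b) = monom_eval \<xi> a * monom_eval \<xi> b"
proof -
  define A where "A = Poly_Mapping.keys a \<union> Poly_Mapping.keys b"
  have A: "finite A" "Poly_Mapping.keys a \<subseteq> A" "Poly_Mapping.keys b \<subseteq> A"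
      "Poly_Mapping.keys (a + b) \<subseteq> A"
    using keys_add[of a b] by (auto simp: A_def)
  show ?thesis
    by (simp add: A monom_eval_superset[OF A(1)] lookup_add power_add prod.distrib)
qed

lemma monom_eval_single: "monom_eval \<xi> (Poly_Mapping.single i k) = \<xi> i ^ k"
  by (cases "k = 0") (auto simp: monom_eval_def)

lemma monom_eval_zero [simp]: "monom_eval \<xi> 0 = 1"
  by (simp add: monom_eval_def)

lemma monom_eval_sum: "monom_eval \<xi> (\<Sum>i\<in>I. m i) = (\<Prod>i\<in>I. monom_eval \<xi> (m i))"
  by (induction I rule: infinite_finite_induct) (auto simp: monom_eval_add)

lemma monom_degree_superset:
  assumes "finite A" "Poly_Mapping.keys m \<subseteq> A"
  shows "monom_degree m = (\<Sum>i\<in>A. Poly_Mapping.lookup m i)"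
  unfolding monom_degree_def using assms by (intro sum.mono_neutral_left) (auto simp: in_keys_iff)

lemma monom_degree_add: "monom_degree (a + b) = monom_degree a + monom_degree b"
proof -
  define A where "A = Poly_Mapping.keys a \<union> Poly_Mapping.keys b"
  have A: "finite A" "Poly_Mapping.keys a \<subseteq> A" "Poly_Mapping.keys b \<subseteq> A"
      "Poly_Mapping.keys (a + b) \<subseteq> A"
    using keys_add[of a b] by (auto simp: A_def)
  show ?thesis
    by (simp add: A monom_degree_superset[OF A(1)] lookup_add sum.distrib)
qed

lemma monom_degree_single: "monom_degree (Poly_Mapping.single i k) = k"
  by (cases "k = 0") (auto simp: monom_degree_def)

lemma monom_degree_sum: "monom_degree (\<Sum>i\<in>I. m i) = (\<Sum>i\<in>I. monom_degree (m i))"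
  by (induction I rule: infinite_finite_induct) (auto simp: monom_degree_add monom_degree_def[of 0])

lemma mpoly_eval_superset:
  assumes "finite A" "Poly_Mapping.keys P \<subseteq> A"
  shows "mpoly_eval \<xi> P = (\<Sum>m\<in>A. Poly_Mapping.lookup P m * monom_eval \<xi> m)"
  unfolding mpoly_eval_def monom_eval_def using assms by (intro sum.mono_neutral_left) (auto simp: in_keys_iff)

lemma mpoly_eval_add: "mpoly_eval (\<xi> :: nat \<Rightarrow> real) (P + Q) = mpoly_eval \<xi> P + mpoly_eval \<xi> Q"
proof -
  define A where "A = Poly_Mapping.keys P \<union> Poly_Mapping.keys Q"
  have A: "finite A" "Poly_Mapping.keys P \<subseteq> A" "Poly_Mapping.keys Q \<subseteq> A"
      "Poly_Mapping.keys (P + Q) \<subseteq> A"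
    using keys_add[of P Q] by (auto simp: A_def)
  show ?thesis
    by (simp add: A mpoly_eval_superset[OF A(1)] lookup_add distrib_right sum.distrib)
qed

lemma mpoly_eval_single:
  "mpoly_eval \<xi> (Poly_Mapping.single m c) = c * monom_eval \<xi> m"
  by (cases "c = 0") (auto simp: mpoly_eval_def monom_eval_def)

lemma mpoly_eval_sum:
  "mpoly_eval (\<xi> :: nat \<Rightarrow> real) (\<Sum>t\<in>T. P t) = (\<Sum>t\<in>T. mpoly_eval \<xi> (P t))"
  by (induction T rule: infinite_finite_induct) (auto simp: mpoly_eval_add mpoly_eval_def[of _ 0])

text \<open>
  The monomials \<open>\<mu> t\<close> may coincide; since all coefficients are \<open>1\<close> nothing cancels, and the
  support is the image of \<open>\<mu>\<close>.
\<close>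

lemma total_degree_homogeneous_sum:
  fixes \<mu> :: "'t \<Rightarrow> nat \<Rightarrow>\<^sub>0 nat"
  assumes "finite T" "T \<noteq> {}" "\<And>t. t \<in> T \<Longrightarrow> monom_degree (\<mu> t) = D"
  shows "mpoly_total_degree (\<Sum>t\<in>T. Poly_Mapping.single (\<mu> t) (1::real)) = D"
proof -
  have look: "Poly_Mapping.lookup (\<Sum>t\<in>T. Poly_Mapping.single (\<mu> t) (1::real)) m
      = (\<Sum>t\<in>T. of_bool (\<mu> t = m))" for m
    unfolding lookup_sum by (intro sum.cong) (auto simp: lookup_single when_def)
  have "Poly_Mapping.keys (\<Sum>t\<in>T. Poly_Mapping.single (\<mu> t) (1::real)) = \<mu> ` T"
    using \<open>finite T\<close> by (auto simp: in_keys_iff look sum_nonneg_eq_0_iff)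
  moreover have "monom_degree ` \<mu> ` T = {D}"
    using assms(2,3) by (auto simp: image_image)
  ultimately show ?thesis unfolding mpoly_total_degree_def by simp
qed

lemma prod_mpoly_var:
  "(\<Prod>i\<in>I. mpoly_var i) = (Poly_Mapping.single (\<Sum>i\<in>I. Poly_Mapping.single i 1) 1 :: real mpoly)"
  by (induction I rule: infinite_finite_induct) (auto simp: mpoly_var_def mult_single)

lemma mpoly_var_power:
  "mpoly_var i ^ r = (Poly_Mapping.single (Poly_Mapping.single i r) 1 :: real mpoly)"
  by (induction r) (auto simp: mpoly_var_def mult_single simp flip: single_add)

lemma mpoly_var_mult:
  "mpoly_var i * mpoly_var j =
     (Poly_Mapping.single (Poly_Mapping.single i 1 + Poly_Mapping.single j 1) 1 :: real mpoly)"
  by (simp add: mpoly_var_def mult_single)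

lemma mpoly_eval_prod_vars:
  "mpoly_eval \<xi> (\<Prod>i\<in>I. mpoly_var i) = (\<Prod>i\<in>I. \<xi> i)"
  for \<xi> :: "nat \<Rightarrow> real"
  unfolding prod_mpoly_var mpoly_eval_single monom_eval_sum monom_eval_single by simp

lemma mpoly_eval_power_sum:
  "mpoly_eval \<xi> (\<Sum>i\<in>I. mpoly_var i ^ r) = (\<Sum>i\<in>I. \<xi> i ^ r)"
  for \<xi> :: "nat \<Rightarrow> real"
  unfolding mpoly_var_power mpoly_eval_sum mpoly_eval_single monom_eval_single by simp

text \<open>
  Writing the quadratic form as a combination of two squares of sums reduces its expansion at the
  floor points to those of sums and powers.
\<close>

lemma sum_upper_triangle:
  fixes x :: "nat \<Rightarrow> real"
  shows "(\<Sum>i=1..d. \<Sum>j=i..d. x i * x j) = ((\<Sum>i=1..d. x i)\<^sup>2 + (\<Sum>i=1..d. (x i)\<^sup>2)) / 2"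
proof (induction d)
  case (Suc d)
  have "(\<Sum>i=1..d. \<Sum>j=i..Suc d. x i * x j) = (\<Sum>i=1..d. (\<Sum>j=i..d. x i * x j) + x i * x (Suc d))"
    by (intro sum.cong) auto
  also have "\<dots> = (\<Sum>i=1..d. \<Sum>j=i..d. x i * x j) + (\<Sum>i=1..d. x i) * x (Suc d)"
    by (simp add: sum.distrib sum_distrib_right)
  finally show ?case using Suc by (simp add: power2_eq_square field_simps)
qed simp

lemma mpoly_eval_complete_quadratic:
  "mpoly_eval \<xi> (\<Sum>i=1..d. \<Sum>j=i..d. mpoly_var i * mpoly_var j)
    = ((\<Sum>i=1..d. \<xi> i)\<^sup>2 + (\<Sum>i=1..d. (\<xi> i)\<^sup>2)) / 2"
  for \<xi> :: "nat \<Rightarrow> real"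
  unfolding mpoly_var_mult mpoly_eval_sum mpoly_eval_single monom_eval_add monom_eval_single
  using sum_upper_triangle[of \<xi> d] by simp

lemma total_degree_prod_vars:
  "mpoly_total_degree (\<Prod>i=1..d. mpoly_var i :: real mpoly) = d"
  using total_degree_homogeneous_sum[of "{()}" "\<lambda>_. \<Sum>i=1..d. Poly_Mapping.single i 1" d]
  unfolding prod_mpoly_var monom_degree_sum monom_degree_single by simp

lemma total_degree_power_sum:
  assumes "d \<ge> 1"
  shows "mpoly_total_degree (\<Sum>i=1..d. mpoly_var i ^ r :: real mpoly) = r"
  unfolding mpoly_var_power using assms
  by (intro total_degree_homogeneous_sum) (auto simp: monom_degree_single)

lemma total_degree_complete_quadratic:
  assumes "d \<ge> 1"
  shows "mpoly_total_degree (\<Sum>i=1..d. \<Sum>j=i..d. mpoly_var i * mpoly_var j :: real mpoly) = 2"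
proof -
  have "(\<Sum>i=1..d. \<Sum>j=i..d. mpoly_var i * mpoly_var j :: real mpoly) =
      (\<Sum>p\<in>Sigma {1..d} (\<lambda>i. {i..d}).
         Poly_Mapping.single (Poly_Mapping.single (fst p) 1 + Poly_Mapping.single (snd p) 1) 1)"
    unfolding mpoly_var_mult by (subst sum.Sigma) (auto simp: case_prod_unfold)
  also have "mpoly_total_degree \<dots> = 2"
  proof (rule total_degree_homogeneous_sum)
    have "(1, 1) \<in> Sigma {1..d} (\<lambda>i. {i..d})" using assms by simp
    then show "Sigma {1..d} (\<lambda>i. {i..d}) \<noteq> {}" by blast
  qed (auto simp: monom_degree_add monom_degree_single)
  finally show ?thesis .
qed

section \<open>Low-degree relations and linear independence\<close>

text \<open>
  The witness is \<open>k x\<^sub>i + l x\<^sub>j - m\<close>, of total degree at most \<open>1\<close>.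
\<close>

lemma linear_relation_imp_algebraic_relation:
  fixes k l m :: int
  assumes "of_int k * \<xi> i + of_int l * \<xi> j = of_int m" "i \<noteq> j" "{i, j} \<subseteq> {1..d}"
    and "k \<noteq> 0 \<or> l \<noteq> 0" "D \<ge> 2"
  shows "satisfies_algebraic_relation_lt d \<xi> D"
proof -
  define P :: "rat mpoly" where "P = Poly_Mapping.single (Poly_Mapping.single i 1) (of_int k)
    + Poly_Mapping.single (Poly_Mapping.single j 1) (of_int l) + Poly_Mapping.single 0 (of_int (- m))"
  have ne: "Poly_Mapping.single i (1::nat) \<noteq> Poly_Mapping.single j 1"
      "Poly_Mapping.single i (1::nat) \<noteq> 0" "Poly_Mapping.single j (1::nat) \<noteq> 0"
    using \<open>i \<noteq> j\<close> by (metis lookup_single_eq lookup_single_not_eq lookup_zero zero_neq_one)+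
  have "Poly_Mapping.lookup P (Poly_Mapping.single i 1) = of_int k"
      "Poly_Mapping.lookup P (Poly_Mapping.single j 1) = of_int l"
    using ne unfolding P_def by (simp_all add: lookup_add lookup_single when_def)
  then have "P \<noteq> 0" using assms(4) by (metis lookup_zero of_int_eq_0_iff)
  have keys: "Poly_Mapping.keys P \<subseteq> {Poly_Mapping.single i 1, Poly_Mapping.single j 1, 0}"
    unfolding P_def
    by (intro order_trans[OF keys_add] Un_least) (auto split: if_splits)
  then have vars: "mpoly_vars P \<subseteq> {1..d}"
    using assms(3) unfolding mpoly_vars_def by (fastforce split: if_splits)
  have "monom_degree ` Poly_Mapping.keys P \<subseteq> {0, 1}"
    using keys monom_degree_single[of i 1] monom_degree_single[of j 1] by (force simp: monom_degree_def[of 0])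
  then have "mpoly_total_degree P \<le> 1" unfolding mpoly_total_degree_def by (subst Max_le_iff) force+
  moreover have "Poly_Mapping.map real_of_rat P = Poly_Mapping.single (Poly_Mapping.single i 1) (of_int k)
    + Poly_Mapping.single (Poly_Mapping.single j 1) (of_int l) + Poly_Mapping.single 0 (of_int (- m))"
    (is "_ = ?R")
  proof (rule poly_mapping_eqI)
    have map: "Poly_Mapping.lookup (Poly_Mapping.map real_of_rat Q) x = of_rat (Poly_Mapping.lookup Q x)"
      for Q :: "rat mpoly" and x
      by (simp add: Poly_Mapping.map.rep_eq when_def)
    have single: "of_rat (Poly_Mapping.lookup (Poly_Mapping.single y (of_int z)) x)
        = Poly_Mapping.lookup (Poly_Mapping.single y (real_of_int z)) x" for x y z
      unfolding lookup_single when_def by (simp only: of_rat_of_int_eq of_rat_0 split: if_split) simp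
    show "Poly_Mapping.lookup (Poly_Mapping.map real_of_rat P) x = Poly_Mapping.lookup ?R x" for x
      by (simp only: P_def map lookup_add of_rat_add single)
  qed
  then have "mpoly_eval \<xi> (Poly_Mapping.map real_of_rat P) = 0"
    using assms(1)
    by (simp only: mpoly_eval_add mpoly_eval_single monom_eval_single monom_eval_zero
        power_one_right of_int_minus)
  ultimately show ?thesis
    using \<open>P \<noteq> 0\<close> vars \<open>D \<ge> 2\<close> unfolding satisfies_algebraic_relation_lt_def
    by (intro exI[of _ P]) auto
qed

lemma no_relation_imp_pairwise_independent:
  assumes "\<not> satisfies_algebraic_relation_lt d \<xi> D" "D \<ge> 2" "d \<ge> 2"
  shows "pairwise_independent_mod_Ints {1..d} \<xi>"
proof -
  have indep: "k = 0 \<and> l = 0"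
    if "i \<in> {1..d}" "j \<in> {1..d}" "i \<noteq> j" "of_int k * \<xi> i + of_int l * \<xi> j \<in> \<int>"
    for i j and k l :: int
  proof (rule ccontr)
    assume "\<not> (k = 0 \<and> l = 0)"
    then have ne: "k \<noteq> 0 \<or> l \<noteq> 0" by simp
    obtain m :: int where m: "of_int k * \<xi> i + of_int l * \<xi> j = of_int m"
      using \<open>of_int k * \<xi> i + of_int l * \<xi> j \<in> \<int>\<close> by (elim Ints_cases)
    show False
      using linear_relation_imp_algebraic_relation[OF m \<open>i \<noteq> j\<close> _ ne \<open>D \<ge> 2\<close>, of d]
        \<open>i \<in> {1..d}\<close> \<open>j \<in> {1..d}\<close> assms(1)
      by simp
  qed
  have "\<xi> i \<notin> \<rat>" if "i \<in> {1..d}" for i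
  proof
    assume "\<xi> i \<in> \<rat>"
    then obtain p q :: int where pq: "q > 0" "\<xi> i = of_int p / of_int q" by (rule Rats_cases') simp
    \<comment> \<open>Irrationality of \<open>\<xi> i\<close> is a relation with coefficient \<open>0\<close> at any second index.\<close>
    obtain j where j: "j \<in> {1..d}" "i \<noteq> j"
    proof
      show "(if i = 1 then 2 else 1) \<in> {1..d}" "i \<noteq> (if i = 1 then 2 else 1)"
        using \<open>d \<ge> 2\<close> by auto
    qed
    have "of_int q * \<xi> i + of_int 0 * \<xi> j = of_int p" using pq by simp
    then have "of_int q * \<xi> i + of_int 0 * \<xi> j \<in> \<int>" by (simp only: Ints_of_int)
    then show False using indep[OF that j] \<open>q > 0\<close> by blast
  qed
  then show ?thesis using indep unfolding pairwise_independent_mod_Ints_def by blast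
qed

section \<open>The two leading orders at the floor points\<close>

abbreviation floor_point :: "(nat \<Rightarrow> real) \<Rightarrow> nat \<Rightarrow> nat \<Rightarrow> real" where
  "floor_point \<alpha> n \<equiv> (\<lambda>i. of_int \<lfloor>of_nat n * \<alpha> i\<rfloor>)"

text \<open>
  At the floor points a monomial of degree \<open>e\<close> divided by \<open>n^e\<close> converges. Hence, if \<open>e < D\<close>,
  division by \<open>n^(D-1)\<close> also leaves a limit, which vanishes unless \<open>e = D - 1\<close>.
\<close>

lemma lower_degree_contribution_convergent:
  assumes "mpoly_total_degree R < D"
  shows "\<exists>c. (\<lambda>n. real n * (mpoly_eval (floor_point \<alpha> n) R / real n ^ D)) \<longlonglongrightarrow> c"
proof -
  have "\<exists>c. (\<lambda>n. real n * (monom_eval (floor_point \<alpha> n) m / real n ^ D)) \<longlonglongrightarrow> c"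
    if m: "m \<in> Poly_Mapping.keys R" for m
  proof -
    define e where "e = monom_degree m"
    have "e \<le> mpoly_total_degree R"
      using m unfolding mpoly_total_degree_def e_def by (intro Max_ge) auto
    then have "e < D" using assms by simp
    \<comment> \<open>The convention \<open>0 ^ 0 = 1\<close> covers the case \<open>e = D - 1\<close>.\<close>
    let ?c = "(\<Prod>i\<in>Poly_Mapping.keys m. \<alpha> i ^ Poly_Mapping.lookup m i) * 0 ^ (D - Suc e)"
    have "(\<lambda>n. (\<Prod>i\<in>Poly_Mapping.keys m. (floor_point \<alpha> n i / real n) ^ Poly_Mapping.lookup m i)
        * (1 / real n) ^ (D - Suc e)) \<longlonglongrightarrow> ?c"
      by (intro tendsto_mult tendsto_prod tendsto_power first_order_tendsto[OF first_order_floor]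
          lim_const_over_n)
    moreover have "\<forall>\<^sub>F n in sequentially.
        (\<Prod>i\<in>Poly_Mapping.keys m. (floor_point \<alpha> n i / real n) ^ Poly_Mapping.lookup m i)
          * (1 / real n) ^ (D - Suc e)
        = real n * (monom_eval (floor_point \<alpha> n) m / real n ^ D)"
      using eventually_gt_at_top[of 0]
    proof eventually_elim
      case (elim n)
      have "(\<Prod>i\<in>Poly_Mapping.keys m. (floor_point \<alpha> n i / real n) ^ Poly_Mapping.lookup m i)
          = monom_eval (floor_point \<alpha> n) m / real n ^ e"
        by (simp add: e_def monom_degree_def monom_eval_def power_divide prod_dividef power_sum)
      moreover have "real n ^ D = real n ^ e * real n * real n ^ (D - Suc e)"
      proof -
        have "D = e + 1 + (D - Suc e)" using \<open>e < D\<close> by simp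
        then have "real n ^ D = real n ^ (e + 1 + (D - Suc e))" by (rule arg_cong)
        then show ?thesis by (simp only: power_add power_one_right)
      qed
      ultimately show ?case using elim by (simp add: power_divide)
    qed
    ultimately have "(\<lambda>n. real n * (monom_eval (floor_point \<alpha> n) m / real n ^ D)) \<longlonglongrightarrow> ?c"
      by (rule Lim_transform_eventually)
    then show ?thesis ..
  qed
  then have "\<forall>m\<in>Poly_Mapping.keys R. \<exists>c.
      (\<lambda>n. real n * (monom_eval (floor_point \<alpha> n) m / real n ^ D)) \<longlonglongrightarrow> c"
    by blast
  from bchoice[OF this] obtain c where c: "\<And>m. m \<in> Poly_Mapping.keys R \<Longrightarrow>
      (\<lambda>n. real n * (monom_eval (floor_point \<alpha> n) m / real n ^ D)) \<longlonglongrightarrow> c m"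
    by blast
  have "(\<lambda>n. \<Sum>m\<in>Poly_Mapping.keys R. Poly_Mapping.lookup R m *
      (real n * (monom_eval (floor_point \<alpha> n) m / real n ^ D)))
      \<longlonglongrightarrow> (\<Sum>m\<in>Poly_Mapping.keys R. Poly_Mapping.lookup R m * c m)"
    by (intro tendsto_sum tendsto_mult_left c)
  moreover have "(\<Sum>m\<in>Poly_Mapping.keys R. Poly_Mapping.lookup R m *
      (real n * (monom_eval (floor_point \<alpha> n) m / real n ^ D)))
      = real n * (mpoly_eval (floor_point \<alpha> n) R / real n ^ D)" for n
    unfolding mpoly_eval_superset[OF finite_keys order_refl] sum_divide_distrib sum_distrib_left
    by (intro sum.cong) auto
  ultimately show ?thesis by auto
qed

lemma first_order_prod_vars:
  "first_order (\<lambda>n. mpoly_eval (floor_point \<alpha> n) (\<Prod>i=1..d. mpoly_var i) / real n ^ d)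
     (\<Prod>i=1..d. \<alpha> i) (\<lambda>n. \<Sum>i=1..d. (\<Prod>j\<in>{1..d} - {i}. \<alpha> j) * frac (real n * \<alpha> i))"
proof -
  have "first_order (\<lambda>n. \<Prod>i=1..d. floor_point \<alpha> n i / n) (\<Prod>i=1..d. \<alpha> i)
      (\<lambda>n. \<Sum>i=1..d. (\<Prod>j\<in>{1..d} - {i}. \<alpha> j) * frac (real n * \<alpha> i))"
    by (intro first_order_prod first_order_floor finite_atLeastAtMost)
  then show ?thesis by (simp add: mpoly_eval_prod_vars prod_dividef)
qed

lemma first_order_power_sum:
  "first_order (\<lambda>n. mpoly_eval (floor_point \<alpha> n) (\<Sum>i=1..d. mpoly_var i ^ r) / real n ^ r)
     (\<Sum>i=1..d. \<alpha> i ^ r) (\<lambda>n. \<Sum>i=1..d. (real r * \<alpha> i ^ (r - 1)) * frac (real n * \<alpha> i))"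
proof -
  have "first_order (\<lambda>n. \<Sum>i=1..d. (floor_point \<alpha> n i / n) ^ r) (\<Sum>i=1..d. \<alpha> i ^ r)
      (\<lambda>n. \<Sum>i=1..d. (real r * \<alpha> i ^ (r - 1)) * frac (real n * \<alpha> i))"
    by (intro first_order_sum first_order_power first_order_floor finite_atLeastAtMost)
  then show ?thesis by (simp add: mpoly_eval_power_sum power_divide flip: sum_divide_distrib)
qed

lemma first_order_complete_quadratic:
  "first_order (\<lambda>n. mpoly_eval (floor_point \<alpha> n) (\<Sum>i=1..d. \<Sum>j=i..d. mpoly_var i * mpoly_var j) / real n ^ 2)
     (((\<Sum>i=1..d. \<alpha> i)\<^sup>2 + (\<Sum>i=1..d. (\<alpha> i)\<^sup>2)) / 2)
     (\<lambda>n. \<Sum>i=1..d. (\<alpha> i + (\<Sum>j=1..d. \<alpha> j)) * frac (real n * \<alpha> i))"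
proof -
  define A where "A = (\<Sum>j=1..d. \<alpha> j)"
  have "first_order
      (\<lambda>n. 1 / 2 * ((\<Sum>i=1..d. floor_point \<alpha> n i / n) ^ 2 + (\<Sum>i=1..d. (floor_point \<alpha> n i / n) ^ 2)))
      (1 / 2 * (A ^ 2 + (\<Sum>i=1..d. \<alpha> i ^ 2)))
      (\<lambda>n. 1 / 2 * (real 2 * A ^ (2 - 1) * (\<Sum>i=1..d. frac (n * \<alpha> i))
         + (\<Sum>i=1..d. real 2 * \<alpha> i ^ (2 - 1) * frac (n * \<alpha> i))))"
    unfolding A_def
    by (intro first_order_cmult first_order_add first_order_power first_order_sum
        first_order_floor finite_atLeastAtMost)
  moreover have "1 / 2 * (real 2 * A ^ (2 - 1) * (\<Sum>i=1..d. frac (n * \<alpha> i))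
         + (\<Sum>i=1..d. real 2 * \<alpha> i ^ (2 - 1) * frac (n * \<alpha> i)))
      = (\<Sum>i=1..d. (\<alpha> i + A) * frac (n * \<alpha> i))" for n :: nat
    by (simp add: distrib_right sum.distrib mult.assoc flip: sum_distrib_left)
  moreover have "1 / 2 * ((\<Sum>i=1..d. floor_point \<alpha> n i / n) ^ 2 + (\<Sum>i=1..d. (floor_point \<alpha> n i / n) ^ 2))
      = mpoly_eval (floor_point \<alpha> n) (\<Sum>i=1..d. \<Sum>j=i..d. mpoly_var i * mpoly_var j) / real n ^ 2" for n :: nat
    unfolding mpoly_eval_complete_quadratic
    by (simp add: power_divide add_divide_distrib flip: sum_divide_distrib)
  ultimately show ?thesis by (simp add: A_def)
qed

text \<open>
  Uniqueness of first-order expansions separates the two leading orders. For a homogeneous \<open>S\<close> of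
  degree \<open>D\<close> the expansions hold with \<open>s\<close> the value and \<open>a\<close> the gradient of \<open>S\<close> at \<open>\<alpha>\<close>, and
  likewise with \<open>t\<close> and \<open>b\<close> at \<open>\<beta>\<close>.
\<close>

lemma value_and_gradient_match:
  fixes \<alpha> \<beta> a b :: "nat \<Rightarrow> real"
  assumes pos: "\<And>i. i \<in> {1..d} \<Longrightarrow> a i > 0" "\<And>i. i \<in> {1..d} \<Longrightarrow> b i > 0"
    and indep: "pairwise_independent_mod_Ints {1..d} \<alpha>" "pairwise_independent_mod_Ints {1..d} \<beta>"
    and exp_\<alpha>: "first_order (\<lambda>n. mpoly_eval (floor_point \<alpha> n) S / real n ^ D) s
        (\<lambda>n. \<Sum>i=1..d. a i * frac (n * \<alpha> i))"
    and exp_\<beta>: "first_order (\<lambda>n. mpoly_eval (floor_point \<beta> n) S / real n ^ D) t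
        (\<lambda>n. \<Sum>i=1..d. b i * frac (n * \<beta> i))"
    and deg: "mpoly_total_degree R < D"
    and eq: "\<And>n::nat. n \<ge> 1 \<Longrightarrow>
        mpoly_eval (floor_point \<alpha> n) (S + R) = mpoly_eval (floor_point \<beta> n) (S + R)"
  obtains \<sigma> where "s = t" "bij_betw \<sigma> {1..d} {1..d}" "\<And>i. i \<in> {1..d} \<Longrightarrow> a i = b (\<sigma> i)"
proof -
  obtain c where c: "(\<lambda>n. real n * (mpoly_eval (floor_point \<alpha> n) R / real n ^ D)) \<longlonglongrightarrow> c"
    using lower_degree_contribution_convergent[OF deg] by blast
  obtain e where e: "(\<lambda>n. real n * (mpoly_eval (floor_point \<beta> n) R / real n ^ D)) \<longlonglongrightarrow> e"
    using lower_degree_contribution_convergent[OF deg] by blast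
  have ev: "\<forall>\<^sub>F n in sequentially.
      mpoly_eval (floor_point \<alpha> n) S / real n ^ D + mpoly_eval (floor_point \<alpha> n) R / real n ^ D =
      mpoly_eval (floor_point \<beta> n) S / real n ^ D + mpoly_eval (floor_point \<beta> n) R / real n ^ D"
    using eventually_ge_at_top[of 1]
    by eventually_elim (use eq in \<open>simp add: mpoly_eval_add flip: add_divide_distrib\<close>)
  note unique = first_order_unique[OF first_order_perturb[OF exp_\<alpha> c] first_order_perturb[OF exp_\<beta> e] ev]
  have "(\<lambda>n. ((\<Sum>i=1..d. a i * frac (n * \<alpha> i)) - c - ((\<Sum>i=1..d. b i * frac (n * \<beta> i)) - e)) + (c - e))
      \<longlonglongrightarrow> 0 + (c - e)"
    by (intro tendsto_add unique(2) tendsto_const)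
  then have "(\<lambda>n. (\<Sum>i=1..d. a i * frac (n * \<alpha> i)) - (\<Sum>i=1..d. b i * frac (n * \<beta> i))) \<longlonglongrightarrow> c - e"
    by simp
  then obtain \<sigma> where "bij_betw \<sigma> {1..d} {1..d}" "\<And>i. i \<in> {1..d} \<Longrightarrow> a i = b (\<sigma> i)"
    using amplitudes_match[of "{1..d}" a b \<alpha> \<beta>, OF finite_atLeastAtMost pos indep] by blast
  then show thesis using that unique(1) by blast
qed

section \<open>Recovering the coordinates from the gradient\<close>

lemma image_eq_if_permuted:
  assumes "bij_betw \<sigma> I I" "\<And>i. i \<in> I \<Longrightarrow> \<alpha> i = \<beta> (\<sigma> i)"
  shows "\<alpha> ` I = \<beta> ` I"
proof -
  have "\<alpha> ` I = \<beta> ` \<sigma> ` I" using assms(2) by (force simp: image_image)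
  then show ?thesis using assms(1) by (simp add: bij_betw_def)
qed

theorem theorem3:
  fixes d r :: nat and K S R :: "real mpoly" and \<alpha> \<beta> :: "nat \<Rightarrow> real"
  assumes "d \<ge> 2" and "r \<ge> 2"
    and "K = S + R"
    and "S = (\<Prod>i=1..d. mpoly_var i) \<or>
         S = (\<Sum>i=1..d. mpoly_var i ^ r) \<or>
         S = (\<Sum>i=1..d. \<Sum>j=i..d. mpoly_var i * mpoly_var j)"
    and "mpoly_vars R \<subseteq> {1..d}"
    and "mpoly_total_degree R < mpoly_total_degree S"
    and "\<And>i. i \<in> {1..d} \<Longrightarrow> \<alpha> i > 0"
    and "\<not> satisfies_algebraic_relation_lt d \<alpha> (mpoly_total_degree S)"
    and "\<And>i. i \<in> {1..d} \<Longrightarrow> \<beta> i > 0"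
    and "\<not> satisfies_algebraic_relation_lt d \<beta> (mpoly_total_degree S)"
    and "\<And>n::nat. n \<ge> 1 \<Longrightarrow>
           mpoly_eval (\<lambda>i. of_int \<lfloor>of_nat n * \<alpha> i\<rfloor>) K =
           mpoly_eval (\<lambda>i. of_int \<lfloor>of_nat n * \<beta> i\<rfloor>) K"
  shows "{\<alpha> i | i. i \<in> {1..d}} = {\<beta> i | i. i \<in> {1..d}}"
proof -
  note eq = assms(11)[unfolded assms(3)]
  note pos = assms(7,9)
  have "mpoly_total_degree S \<ge> 2"
    using assms(4) total_degree_prod_vars[of d] total_degree_power_sum[of d r]
      total_degree_complete_quadratic[of d] \<open>d \<ge> 2\<close> \<open>r \<ge> 2\<close> by auto
  then have indep: "pairwise_independent_mod_Ints {1..d} \<alpha>" "pairwise_independent_mod_Ints {1..d} \<beta>"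
    using no_relation_imp_pairwise_independent assms(8,10) \<open>d \<ge> 2\<close> by blast+
  have "\<exists>\<sigma>. bij_betw \<sigma> {1..d} {1..d} \<and> (\<forall>i\<in>{1..d}. \<alpha> i = \<beta> (\<sigma> i))"
    using assms(4)
  proof (elim disjE)
    assume S: "S = (\<Prod>i=1..d. mpoly_var i)"
    define G where "G = (\<lambda>\<xi> i. \<Prod>j\<in>{1..d} - {i}. \<xi> j :: real)"
    have G: "G \<alpha> i > 0" "G \<beta> i > 0" if "i \<in> {1..d}" for i
      unfolding G_def using pos by (auto intro!: prod_pos)
    have deg: "mpoly_total_degree R < d" using assms(6) unfolding S total_degree_prod_vars .
    have expansion: "first_order (\<lambda>n. mpoly_eval (floor_point \<xi> n) S / real n ^ d)
        (\<Prod>i=1..d. \<xi> i) (\<lambda>n. \<Sum>i=1..d. G \<xi> i * frac (real n * \<xi> i))" for \<xi>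
      using first_order_prod_vars[of \<xi> d] by (simp only: S G_def)
    obtain \<sigma> where \<sigma>: "(\<Prod>i=1..d. \<alpha> i) = (\<Prod>i=1..d. \<beta> i)" "bij_betw \<sigma> {1..d} {1..d}"
        "\<And>i. i \<in> {1..d} \<Longrightarrow> G \<alpha> i = G \<beta> (\<sigma> i)"
      using value_and_gradient_match[of d "G \<alpha>" "G \<beta>", OF G indep
        expansion expansion deg eq]
      by blast
    have "\<alpha> i = \<beta> (\<sigma> i)" if "i \<in> {1..d}" for i
    proof -
      have "\<sigma> i \<in> {1..d}" using \<sigma>(2) that by (auto dest: bij_betwE)
      then have "\<alpha> i * G \<alpha> i = \<beta> (\<sigma> i) * G \<beta> (\<sigma> i)"
        using \<sigma>(1) that by (simp add: G_def flip: prod.remove)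
      then show ?thesis using \<sigma>(3)[OF that] G(2)[OF \<open>\<sigma> i \<in> {1..d}\<close>] by simp
    qed
    then show ?thesis using \<sigma>(2) by blast
  next
    assume S: "S = (\<Sum>i=1..d. mpoly_var i ^ r)"
    define G where "G = (\<lambda>\<xi> (i::nat). real r * \<xi> i ^ (r - 1))"
    have G: "G \<alpha> i > 0" "G \<beta> i > 0" if "i \<in> {1..d}" for i
      unfolding G_def using pos that \<open>r \<ge> 2\<close> by auto
    have deg: "mpoly_total_degree R < r"
      using assms(6) total_degree_power_sum[of d r] \<open>d \<ge> 2\<close> unfolding S by simp
    have expansion: "first_order (\<lambda>n. mpoly_eval (floor_point \<xi> n) S / real n ^ r)
        (\<Sum>i=1..d. \<xi> i ^ r) (\<lambda>n. \<Sum>i=1..d. G \<xi> i * frac (real n * \<xi> i))" for \<xi>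
      using first_order_power_sum[of \<xi> r d] by (simp only: S G_def)
    obtain \<sigma> where \<sigma>: "bij_betw \<sigma> {1..d} {1..d}" "\<And>i. i \<in> {1..d} \<Longrightarrow> G \<alpha> i = G \<beta> (\<sigma> i)"
      using value_and_gradient_match[of d "G \<alpha>" "G \<beta>", OF G indep
        expansion expansion deg eq]
      by blast
    have "\<alpha> i = \<beta> (\<sigma> i)" if "i \<in> {1..d}" for i
    proof -
      have "\<sigma> i \<in> {1..d}" using \<sigma>(1) that by (auto dest: bij_betwE)
      then have "\<alpha> i ^ (r - 1) = \<beta> (\<sigma> i) ^ (r - 1)" "\<alpha> i \<ge> 0" "\<beta> (\<sigma> i) \<ge> 0"
        using \<sigma>(2)[OF that] \<open>r \<ge> 2\<close> pos that by (auto simp: G_def less_imp_le)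
      then show ?thesis by (rule power_eq_imp_eq_base) (use \<open>r \<ge> 2\<close> in simp)
    qed
    then show ?thesis using \<sigma>(1) by blast
  next
    assume S: "S = (\<Sum>i=1..d. \<Sum>j=i..d. mpoly_var i * mpoly_var j)"
    define G where "G = (\<lambda>\<xi> i. \<xi> i + (\<Sum>j=1..d. \<xi> j) :: real)"
    have G: "G \<alpha> i > 0" "G \<beta> i > 0" if "i \<in> {1..d}" for i
      unfolding G_def using pos that by (auto intro!: add_pos_pos sum_pos)
    have deg: "mpoly_total_degree R < 2"
      using assms(6) total_degree_complete_quadratic[of d] \<open>d \<ge> 2\<close> unfolding S by simp
    have expansion: "first_order (\<lambda>n. mpoly_eval (floor_point \<xi> n) S / real n ^ 2)
        (((\<Sum>i=1..d. \<xi> i)\<^sup>2 + (\<Sum>i=1..d. (\<xi> i)\<^sup>2)) / 2) (\<lambda>n. \<Sum>i=1..d. G \<xi> i * frac (real n * \<xi> i))" for \<xi>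
      using first_order_complete_quadratic[of \<xi> d] by (simp only: S G_def)
    obtain \<sigma> where \<sigma>: "bij_betw \<sigma> {1..d} {1..d}" "\<And>i. i \<in> {1..d} \<Longrightarrow> G \<alpha> i = G \<beta> (\<sigma> i)"
      using value_and_gradient_match[of d "G \<alpha>" "G \<beta>", OF G indep
        expansion expansion deg eq]
      by blast
    have sumG: "(\<Sum>i=1..d. G \<xi> i) = (real d + 1) * (\<Sum>i=1..d. \<xi> i)" for \<xi>
      by (simp add: G_def sum.distrib algebra_simps)
    have "(\<Sum>i=1..d. G \<alpha> i) = (\<Sum>i=1..d. G \<beta> (\<sigma> i))" using \<sigma>(2) by (rule sum.cong[OF refl])
    also have "\<dots> = (\<Sum>i=1..d. G \<beta> i)" using \<sigma>(1) by (rule sum.reindex_bij_betw)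
    finally have "(\<Sum>i=1..d. \<alpha> i) = (\<Sum>i=1..d. \<beta> i)"
      unfolding sumG by (simp add: add_nonneg_eq_0_iff)
    then have "\<alpha> i = \<beta> (\<sigma> i)" if "i \<in> {1..d}" for i
      using \<sigma>(2)[OF that] by (simp add: G_def)
    then show ?thesis using \<sigma>(1) by blast
  qed
  then obtain \<sigma> where "bij_betw \<sigma> {1..d} {1..d}" "\<And>i. i \<in> {1..d} \<Longrightarrow> \<alpha> i = \<beta> (\<sigma> i)" by blast
  then have "\<alpha> ` {1..d} = \<beta> ` {1..d}" by (rule image_eq_if_permuted)
  then show ?thesis by (simp only: image_def) blast
qed

end
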